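(* Let $R$ be an integral domain, let $\Theta$ be a Jaffard family on $R$, and let $\ast\in\mathrm{Star}(R)$. Then $\ast$ is of finite type (respectively, semifinite, stable, spectral, Noetherian) if and only if $\ast_T$ is of finite type (respectively, semifinite, stable, spectral, Noetherian) for every $T\in\Theta$.
   Context: Let $R$ be an integral domain with quotient field $K$. $\mathcal{F}(R)$ is the set of fractional ideals of $R$ (the $R$-submodules $I$ of $K$ with $dI\subseteq R$ for some nonzero $d\in R$). A star operation on $R$ is a map $\ast:\mathcal{F}(R)\to\mathcal{F}(R)$, $I\mapsto I^\ast$, such that for all $I,J\in\mathcal{F}(R)$, $x\in K$: $I\subseteq I^\ast$; $(I^\ast)^\ast=I^\ast$; $I\subseteq J$ implies $I^\ast\subseteq J^\ast$; $R^\ast=R$; $(xI)^\ast=xI^\ast$. $\mathrm{Star}(R)$ is the set of star operations on $R$. An ideal $I$ is a $\ast$-ideal (or $\ast$-closed) if $I=I^\ast$. A star operation $\ast$ is: of finite type if $I^\ast=\bigcup\{J^\ast\mid J\subseteq I,\ J\text{ finitely generated}\}$ for every $I$; semifinite if every proper (integral) $\ast$-ideal is contained in a prime $\ast$-ideal; stable if $(I\cap J)^\ast=I^\ast\cap J^\ast$ for all ideals $I,J$; spectral if there is $\Delta\subseteq\mathrm{Spec}(R)$ with $I^\ast=\bigcap\{IR_P\mid P\in\Delta\}$ for all $I$; Noetherian if every ascending chain of (integral) $\ast$-closed ideals stabilizes. An overring of $R$ is a ring $T$ with $R\subseteq T\subseteq K$. A set $\Theta$ of overrings is locally finite if every nonzero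 $x\in R$ is a nonunit in only finitely many $T\in\Theta$. A Jaffard family on $R$ is a set $\Theta$ of overrings of $R$ with $K\notin\Theta$ such that: $R=\bigcap_{T\in\Theta}T$; $\Theta$ is locally finite; and, for every nonzero integral ideal $I$ of $R$, $I=\prod_{T\in\Theta}(IT\cap R)$ (a finite product, since $IT=T$ for all but finitely many $T$) and $(IT\cap R)+(IS\cap R)=R$ for all $T\neq S$ in $\Theta$. Members of a Jaffard family are flat over $R$. For $T$ in a Jaffard family on $R$ and $\ast\in\mathrm{Star}(R)$, the map $\ast_T:\mathcal{F}(T)\to\mathcal{F}(T)$, $IT\mapsto I^\ast T$ ($I\in\mathcal{F}(R)$), is a well-defined star operation on $T$. *)

theory Defs
  imports Complex_Main
begin

text \<open>
  The quotient field \<open>K\<close> is the whole type \<open>'k::field\<close>; the domain \<open>R\<close>, its overrings, and all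
  modules over them are subsets of \<open>'k\<close>.
\<close>

subsection \<open>Subrings of a field and their submodules\<close>

definition subring_of_field :: "'k::field set \<Rightarrow> bool" where
  "subring_of_field R \<longleftrightarrow>
     1 \<in> R \<and> (\<forall>x\<in>R. \<forall>y\<in>R. x - y \<in> R) \<and> (\<forall>x\<in>R. \<forall>y\<in>R. x * y \<in> R)"

text \<open>A subring of a field is automatically an integral domain; the second conjunct says that its
  quotient field is all of \<open>'k\<close>.\<close>

definition domain_with_quotient_field :: "'k::field set \<Rightarrow> bool" where
  "domain_with_quotient_field R \<longleftrightarrow>
     subring_of_field R \<and> (\<forall>x. \<exists>a\<in>R. \<exists>b\<in>R. b \<noteq> 0 \<and> x = a / b)"

definition overring :: "'k::field set \<Rightarrow> 'k set \<Rightarrow> bool" where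
  "overring R T \<longleftrightarrow> subring_of_field T \<and> R \<subseteq> T"

definition submodule_over :: "'k::field set \<Rightarrow> 'k set \<Rightarrow> bool" where
  "submodule_over R I \<longleftrightarrow>
     0 \<in> I \<and> (\<forall>x\<in>I. \<forall>y\<in>I. x + y \<in> I) \<and> (\<forall>r\<in>R. \<forall>x\<in>I. r * x \<in> I)"

definition fractional_ideals :: "'k::field set \<Rightarrow> 'k set set" where
  "fractional_ideals R =
     {I. submodule_over R I \<and> (\<exists>d\<in>R. d \<noteq> 0 \<and> (\<lambda>y. d * y) ` I \<subseteq> R)}"

definition integral_ideal :: "'k::field set \<Rightarrow> 'k set \<Rightarrow> bool" where
  "integral_ideal R I \<longleftrightarrow> submodule_over R I \<and> I \<subseteq> R"

definition Spec_of :: "'k::field set \<Rightarrow> 'k set set" where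
  "Spec_of R = {P. integral_ideal R P \<and> P \<noteq> R \<and>
     (\<forall>x\<in>R. \<forall>y\<in>R. x * y \<in> P \<longrightarrow> x \<in> P \<or> y \<in> P)}"

definition finitely_generated_over :: "'k::field set \<Rightarrow> 'k set \<Rightarrow> bool" where
  "finitely_generated_over R J \<longleftrightarrow> (\<exists>X. finite X \<and> J = submodule_over R hull X)"

text \<open>\<open>ext T I\<close> is the extension \<open>IT\<close>: the \<open>T\<close>-submodule of the quotient field generated by \<open>I\<close>.\<close>

definition ext :: "'k::field set \<Rightarrow> 'k set \<Rightarrow> 'k set" where
  "ext T I = submodule_over T hull I"

definition localization :: "'k::field set \<Rightarrow> 'k set \<Rightarrow> 'k set" where
  "localization R P = {a / s |a s. a \<in> R \<and> s \<in> R \<and> s \<notin> P}"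

text \<open>The product of the ideals \<open>A i\<close> over a finite index set \<open>S\<close>; it is \<open>R\<close> if \<open>S\<close> is empty.\<close>

definition ideal_product :: "'k::field set \<Rightarrow> 'i set \<Rightarrow> ('i \<Rightarrow> 'k set) \<Rightarrow> 'k set" where
  "ideal_product R S A = submodule_over R hull {\<Prod>i\<in>S. f i |f. \<forall>i\<in>S. f i \<in> A i}"

subsection \<open>Jaffard families\<close>

definition locally_finite_family :: "'k::field set \<Rightarrow> 'k set set \<Rightarrow> bool" where
  "locally_finite_family R \<Theta> \<longleftrightarrow>
     (\<forall>x\<in>R. x \<noteq> 0 \<longrightarrow> finite {T \<in> \<Theta>. \<not> (\<exists>y\<in>T. x * y = 1)})"

text \<open>
  The product over \<open>\<Theta>\<close> is taken over those \<open>T\<close> with \<open>IT \<noteq> T\<close>, since the remaining factors are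
  \<open>IT \<inter> R = R\<close>. This index set is finite because \<open>\<Theta>\<close> is locally finite and \<open>I \<noteq> 0\<close>.
\<close>

definition jaffard_family :: "'k::field set \<Rightarrow> 'k set set \<Rightarrow> bool" where
  "jaffard_family R \<Theta> \<longleftrightarrow>
     (\<forall>T\<in>\<Theta>. overring R T) \<and> UNIV \<notin> \<Theta> \<and>
     R = \<Inter>\<Theta> \<and>
     locally_finite_family R \<Theta> \<and>
     (\<forall>I. integral_ideal R I \<and> I \<noteq> {0} \<longrightarrow>
        I = ideal_product R {T \<in> \<Theta>. ext T I \<noteq> T} (\<lambda>T. ext T I \<inter> R) \<and>
        (\<forall>T\<in>\<Theta>. \<forall>S\<in>\<Theta>. T \<noteq> S \<longrightarrow> {a + b |a b. a \<in> ext T I \<inter> R \<and> b \<in> ext S I \<inter> R} = R))"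

subsection \<open>Star operations\<close>

text \<open>Only the values of a star operation on the fractional ideals of \<open>R\<close> matter; outside
  \<open>fractional_ideals R\<close> the function is arbitrary.\<close>

definition Star :: "'k::field set \<Rightarrow> ('k set \<Rightarrow> 'k set) set" where
  "Star R = {star.
     (\<forall>I\<in>fractional_ideals R. star I \<in> fractional_ideals R) \<and>
     (\<forall>I\<in>fractional_ideals R. I \<subseteq> star I) \<and>
     (\<forall>I\<in>fractional_ideals R. star (star I) = star I) \<and>
     (\<forall>I\<in>fractional_ideals R. \<forall>J\<in>fractional_ideals R. I \<subseteq> J \<longrightarrow> star I \<subseteq> star J) \<and>
     star R = R \<and>
     (\<forall>I\<in>fractional_ideals R. \<forall>x. star ((\<lambda>y. x * y) ` I) = (\<lambda>y. x * y) ` star I)}"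

text \<open>The map \<open>IT \<mapsto> I\<^sup>* T\<close> on fractional ideals of \<open>T\<close>: \<open>star_at R star T A\<close> is the common value of
  \<open>I\<^sup>* T\<close> over all fractional ideals \<open>I\<close> of \<open>R\<close> with \<open>IT = A\<close>.\<close>

definition star_at ::
    "'k::field set \<Rightarrow> ('k set \<Rightarrow> 'k set) \<Rightarrow> 'k set \<Rightarrow> 'k set \<Rightarrow> 'k set" where
  "star_at R star T A = (THE B. \<exists>I\<in>fractional_ideals R. A = ext T I \<and> B = ext T (star I))"

definition star_finite_type :: "'k::field set \<Rightarrow> ('k set \<Rightarrow> 'k set) \<Rightarrow> bool" where
  "star_finite_type R star \<longleftrightarrow>
     (\<forall>I\<in>fractional_ideals R. star I = \<Union>{star J |J. J \<subseteq> I \<and> finitely_generated_over R J})"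

definition star_semifinite :: "'k::field set \<Rightarrow> ('k set \<Rightarrow> 'k set) \<Rightarrow> bool" where
  "star_semifinite R star \<longleftrightarrow>
     (\<forall>I. integral_ideal R I \<and> I \<noteq> R \<and> star I = I \<longrightarrow>
        (\<exists>P\<in>Spec_of R. star P = P \<and> I \<subseteq> P))"

definition star_stable :: "'k::field set \<Rightarrow> ('k set \<Rightarrow> 'k set) \<Rightarrow> bool" where
  "star_stable R star \<longleftrightarrow>
     (\<forall>I\<in>fractional_ideals R. \<forall>J\<in>fractional_ideals R. star (I \<inter> J) = star I \<inter> star J)"

definition star_spectral :: "'k::field set \<Rightarrow> ('k set \<Rightarrow> 'k set) \<Rightarrow> bool" where
  "star_spectral R star \<longleftrightarrow>
     (\<exists>\<Delta>\<subseteq>Spec_of R. \<forall>I\<in>fractional_ideals R. star I = \<Inter>{ext (localization R P) I |P. P \<in> \<Delta>})"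

definition star_noetherian :: "'k::field set \<Rightarrow> ('k set \<Rightarrow> 'k set) \<Rightarrow> bool" where
  "star_noetherian R star \<longleftrightarrow>
     (\<forall>I :: nat \<Rightarrow> 'k set.
        (\<forall>n. integral_ideal R (I n) \<and> star (I n) = I n) \<and> (\<forall>n. I n \<subseteq> I (Suc n)) \<longrightarrow>
        (\<exists>N. \<forall>n\<ge>N. I n = I N))"

end

theory Submission
  imports Defs
begin

text \<open>
  For \<open>T \<in> \<Theta>\<close> and an \<open>R\<close>-submodule \<open>I\<close> of the quotient field, \<open>z \<in> IT\<close> holds iff the ideal
  \<open>(I : z)\<close> of \<open>R\<close> extends to all of \<open>T\<close>. Since a nonzero ideal of \<open>R\<close> extends to all but finitely
  many members of \<open>\<Theta>\<close>, and only \<open>R\<close> extends to all of them, a nonzero \<open>I\<close> is the intersection of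
  the \<open>IT\<close>, and a given \<open>z\<close> lies in almost all \<open>IT\<close>. The factorization of a nonzero ideal \<open>I\<close>
  gives an ideal \<open>H\<close> with \<open>HT = T\<close> and \<open>H(IT \<inter> R) \<subseteq> I\<close>, which makes \<open>IT \<mapsto> I\<^sup>*T\<close> well defined. So
  \<open>I\<^sup>*\<close> is determined by the \<open>I\<^sup>*T\<close>, and each of the five properties can be checked on the members
  of \<open>\<Theta>\<close>; a prime of \<open>R\<close> containing a nonzero \<open>A \<inter> R\<close>, with \<open>A\<close> an ideal of \<open>T\<close>, extends to a
  prime of \<open>T\<close>, because it extends to the unit ideal in every other member of \<open>\<Theta>\<close>.
\<close>

subsection \<open>Extensions of modules\<close>

lemma subring_of_fieldD:
  assumes "subring_of_field T"
  shows "1 \<in> T" "0 \<in> T" "\<And>x y. x \<in> T \<Longrightarrow> y \<in> T \<Longrightarrow> x + y \<in> T"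
    "\<And>x y. x \<in> T \<Longrightarrow> y \<in> T \<Longrightarrow> x * y \<in> T"
proof -
  show 1: "1 \<in> T" and "\<And>x y. x \<in> T \<Longrightarrow> y \<in> T \<Longrightarrow> x * y \<in> T"
    using assms by (auto simp: subring_of_field_def)
  have d: "\<And>x y. x \<in> T \<Longrightarrow> y \<in> T \<Longrightarrow> x - y \<in> T"
    using assms by (auto simp: subring_of_field_def)
  show 0: "0 \<in> T"
    using d[OF 1 1] by simp
  show "x + y \<in> T" if "x \<in> T" "y \<in> T" for x y
    using d[OF that(1) d[OF 0 that(2)]] by simp
qed

lemma submodule_overD:
  assumes "submodule_over R I"
  shows "0 \<in> I" "\<And>x y. x \<in> I \<Longrightarrow> y \<in> I \<Longrightarrow> x + y \<in> I"
    "\<And>r x. r \<in> R \<Longrightarrow> x \<in> I \<Longrightarrow> r * x \<in> I"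
  using assms by (auto simp: submodule_over_def)

lemma submodule_over_self: "subring_of_field T \<Longrightarrow> submodule_over T T"
  using subring_of_fieldD[of T] by (auto simp: submodule_over_def)

lemma submodule_over_mono: "submodule_over T I \<Longrightarrow> R \<subseteq> T \<Longrightarrow> submodule_over R I"
  by (auto simp: submodule_over_def)

lemma submodule_over_Int: "submodule_over R I \<Longrightarrow> submodule_over R J \<Longrightarrow> submodule_over R (I \<inter> J)"
  by (auto simp: submodule_over_def)

lemma submodule_over_zero: "submodule_over R {0}"
  by (auto simp: submodule_over_def)

lemma submodule_over_scale:
  assumes "submodule_over R I"
  shows "submodule_over R ((*) x ` I)"
proof -
  have "x * a + x * b \<in> (*) x ` I" if "a \<in> I" "b \<in> I" for a b
    using submodule_overD(2)[OF assms that] by (metis distrib_left imageI)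
  moreover have "r * (x * a) \<in> (*) x ` I" if "r \<in> R" "a \<in> I" for r a
    using submodule_overD(3)[OF assms that] by (metis mult.left_commute imageI)
  moreover have "0 \<in> (*) x ` I"
    using submodule_overD(1)[OF assms] by (metis mult_zero_right imageI)
  ultimately show ?thesis
    by (auto simp: submodule_over_def)
qed

lemma submodule_over_ext: "submodule_over T (ext T I)"
  unfolding ext_def by (rule hull_in) (auto simp: submodule_over_def)

lemma subset_ext: "I \<subseteq> ext T I"
  unfolding ext_def by (rule hull_subset)

lemma ext_minimal: "submodule_over T M \<Longrightarrow> I \<subseteq> M \<Longrightarrow> ext T I \<subseteq> M"
  unfolding ext_def by (rule hull_minimal)

lemma ext_mono: "I \<subseteq> J \<Longrightarrow> ext T I \<subseteq> ext T J"
  unfolding ext_def by (rule hull_mono)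

lemma ext_monoD: "z \<in> ext T I \<Longrightarrow> I \<subseteq> J \<Longrightarrow> z \<in> ext T J"
  by (rule subsetD[OF ext_mono])

lemma ext_eq: "submodule_over T I \<Longrightarrow> ext T I = I"
  by (intro subset_antisym ext_minimal subset_ext order_refl)

lemma ext_zero: "ext T {0} = {0}"
  by (simp add: ext_eq submodule_over_zero)

lemma ext_ext:
  assumes "S \<subseteq> T"
  shows "ext T (ext S I) = ext T I"
proof
  show "ext T (ext S I) \<subseteq> ext T I"
    by (intro ext_minimal submodule_over_ext submodule_over_mono[OF submodule_over_ext assms] subset_ext)
  show "ext T I \<subseteq> ext T (ext S I)"
    by (intro ext_mono subset_ext)
qed

lemma finitely_generated_over_iff: "finitely_generated_over R J \<longleftrightarrow> (\<exists>X. finite X \<and> J = ext R X)"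
  by (simp add: finitely_generated_over_def ext_def)

text \<open>The \<open>c\<close> with \<open>a * c\<close> in \<open>M\<close> form a
  \<open>T\<close>-submodule, so it suffices to test the generators.\<close>

lemma mult_ext_mem:
  assumes M: "submodule_over T M" and "\<And>b. b \<in> X \<Longrightarrow> a * b \<in> M" and "c \<in> ext T X"
  shows "a * c \<in> M"
proof -
  have "a * r * x \<in> M" if "r \<in> T" "a * x \<in> M" for r x
    using submodule_overD(3)[OF M that] by (simp add: ac_simps)
  then have "submodule_over T {c. a * c \<in> M}"
    using submodule_overD[OF M] by (auto simp: submodule_over_def distrib_left ac_simps)
  then have "ext T X \<subseteq> {c. a * c \<in> M}"
    using assms(2) by (intro ext_minimal) auto
  then show ?thesis
    using assms(3) by auto
qed

text \<open>Writing \<open>1\<close> as a \<open>T\<close>-combination of elements of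
  \<open>H\<close> makes \<open>z\<close> a \<open>T\<close>-combination of the products
  \<open>z * h\<close>. Many memberships in \<open>T\<close>-modules below are reduced to those of
  such products.\<close>

lemma mem_if_one_mem_ext:
  assumes "submodule_over T M" "\<And>h. h \<in> H \<Longrightarrow> z * h \<in> M" "1 \<in> ext T H"
  shows "z \<in> M"
  using mult_ext_mem[OF assms(1,2,3)] by simp

lemma ext_scale: "ext T ((*) x ` I) = (*) x ` ext T I"
proof
  show "ext T ((*) x ` I) \<subseteq> (*) x ` ext T I"
    by (intro ext_minimal submodule_over_scale submodule_over_ext image_mono subset_ext)
  show "(*) x ` ext T I \<subseteq> ext T ((*) x ` I)"
    using mult_ext_mem[OF submodule_over_ext, of I x T "(*) x ` I"] subset_ext[of "(*) x ` I" T]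
    by blast
qed

text \<open>The preceding criterion is used twice: letting \<open>b\<close> range over
  \<open>G\<close> puts each \<open>a\<close> from \<open>H\<close> into the extension of the
  products, and then letting \<open>a\<close> range over \<open>H\<close> yields
  \<open>1\<close>.\<close>

lemma one_mem_ext_mult:
  assumes "1 \<in> ext T H" "1 \<in> ext T G"
  shows "1 \<in> ext T {a * b |a b. a \<in> H \<and> b \<in> G}" (is "1 \<in> ext T ?P")
proof -
  have "a * b \<in> ext T ?P" if "a \<in> H" "b \<in> G" for a b
    using that by (intro subsetD[OF subset_ext]) blast
  then have "a \<in> ext T ?P" if "a \<in> H" for a
    using mem_if_one_mem_ext[OF submodule_over_ext _ assms(2), where z = a] that by simp
  then show ?thesis
    using mem_if_one_mem_ext[OF submodule_over_ext _ assms(1), where z = 1] by simp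
qed

text \<open>The intersection of two ideals contains all products of their elements.\<close>

lemma one_mem_ext_Int:
  assumes "1 \<in> ext T H" "1 \<in> ext T G" "integral_ideal R H" "integral_ideal R G"
  shows "1 \<in> ext T (H \<inter> G)"
proof -
  have "a * b \<in> H \<inter> G" if "a \<in> H" "b \<in> G" for a b
    using assms(3,4) that submodule_overD(3)[of R H b a] submodule_overD(3)[of R G a b]
    by (auto simp: integral_ideal_def mult.commute)
  then have "{a * b |a b. a \<in> H \<and> b \<in> G} \<subseteq> H \<inter> G"
    by auto
  with one_mem_ext_mult[OF assms(1,2)] show ?thesis
    by (rule ext_monoD)
qed

lemma one_mem_ext_prod:
  assumes "finite F" "\<And>S. S \<in> F \<Longrightarrow> 1 \<in> ext T (A S)"
  shows "1 \<in> ext T {\<Prod>S\<in>F. f S |f. \<forall>S\<in>F. f S \<in> A S}"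
  using assms
proof (induction F)
  case empty
  then show ?case
    using subset_ext[of "{1}" T] by simp
next
  case (insert S F)
  have "a * (\<Prod>S\<in>F. f S) \<in> {\<Prod>S\<in>insert S F. f S |f. \<forall>S\<in>insert S F. f S \<in> A S}"
    if "a \<in> A S" "\<forall>S\<in>F. f S \<in> A S" for a f
  proof -
    have "(\<Prod>U\<in>F. (f(S := a)) U) = (\<Prod>U\<in>F. f U)"
      using insert.hyps by (intro prod.cong) auto
    then have "a * (\<Prod>S\<in>F. f S) = (\<Prod>U\<in>insert S F. (f(S := a)) U)"
      using insert.hyps by simp
    moreover have "\<forall>U\<in>insert S F. (f(S := a)) U \<in> A U"
      using that by auto
    ultimately show ?thesis
      by blast
  qed
  then have "{a * b |a b. a \<in> A S \<and> b \<in> {\<Prod>S\<in>F. f S |f. \<forall>S\<in>F. f S \<in> A S}}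
      \<subseteq> {\<Prod>S\<in>insert S F. f S |f. \<forall>S\<in>insert S F. f S \<in> A S}"
    by blast
  moreover have "1 \<in> ext T {a * b |a b. a \<in> A S \<and> b \<in> {\<Prod>S\<in>F. f S |f. \<forall>S\<in>F. f S \<in> A S}}"
    using insert.prems by (intro one_mem_ext_mult insert.IH) auto
  ultimately show ?case
    by (rule subsetD[OF ext_mono])
qed

text \<open>The elements reached from finite subsets of \<open>X\<close> form a
  \<open>T\<close>-submodule containing \<open>X\<close>; for a sum, the two finite subsets are
  united.\<close>

lemma ext_finite_subset:
  assumes "z \<in> ext T X"
  shows "\<exists>Y. finite Y \<and> Y \<subseteq> X \<and> z \<in> ext T Y"
proof -
  let ?M = "{z. \<exists>Y. finite Y \<and> Y \<subseteq> X \<and> z \<in> ext T Y}"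
  have "x + y \<in> ?M" if xy: "x \<in> ?M" "y \<in> ?M" for x y
  proof -
    obtain Y Z where Y: "finite Y" "Y \<subseteq> X" "x \<in> ext T Y" and Z: "finite Z" "Z \<subseteq> X" "y \<in> ext T Z"
      using xy by blast
    then have "x \<in> ext T (Y \<union> Z)" "y \<in> ext T (Y \<union> Z)"
      using ext_mono[of Y "Y \<union> Z" T] ext_mono[of Z "Y \<union> Z" T] by auto
    then have "x + y \<in> ext T (Y \<union> Z)"
      by (rule submodule_overD(2)[OF submodule_over_ext])
    then show ?thesis
      using Y Z by (intro CollectI exI[of _ "Y \<union> Z"]) auto
  qed
  moreover have "0 \<in> ?M"
    using submodule_overD(1)[OF submodule_over_ext, of T "{}"] by blast
  moreover have "r * x \<in> ?M" if "r \<in> T" "x \<in> ?M" for r x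
    using that submodule_overD(3)[OF submodule_over_ext, of r T x] by blast
  ultimately have "submodule_over T ?M"
    unfolding submodule_over_def by (intro conjI ballI)
  moreover have "X \<subseteq> ?M"
  proof
    fix x assume "x \<in> X"
    then show "x \<in> ?M"
      using subset_ext[of "{x}" T] by (intro CollectI exI[of _ "{x}"]) auto
  qed
  ultimately have "ext T X \<subseteq> ?M"
    by (rule ext_minimal)
  then show ?thesis
    using assms by blast
qed

lemma finite_subset_ext:
  assumes "finite Y" "Y \<subseteq> ext T X"
  shows "\<exists>Z. finite Z \<and> Z \<subseteq> X \<and> Y \<subseteq> ext T Z"
proof -
  have "\<forall>y\<in>Y. \<exists>Z. finite Z \<and> Z \<subseteq> X \<and> y \<in> ext T Z"
    using ext_finite_subset assms(2) by blast
  from bchoice[OF this] obtain f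
    where f: "\<And>y. y \<in> Y \<Longrightarrow> finite (f y) \<and> f y \<subseteq> X \<and> y \<in> ext T (f y)"
    by auto
  have "y \<in> ext T (\<Union>(f ` Y))" if "y \<in> Y" for y
    using f[OF that] that by (auto intro: ext_monoD[of y T "f y"])
  then have "Y \<subseteq> ext T (\<Union>(f ` Y))"
    by blast
  moreover have "finite (\<Union>(f ` Y))"
    using f assms(1) by simp
  moreover have "\<Union>(f ` Y) \<subseteq> X"
    using f by (intro UN_least) simp
  ultimately show ?thesis
    by (intro exI conjI)
qed

section \<open>Colon ideals, fractional ideals and primes\<close>

text \<open>This is the colon ideal \<open>(I : z)\<close>; for \<open>I = R\<close> it is the ideal
  of denominators of \<open>z\<close>.\<close>

definition colon :: "'k::field set \<Rightarrow> 'k set \<Rightarrow> 'k \<Rightarrow> 'k set" where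
  "colon R I z = {r \<in> R. r * z \<in> I}"

lemma integral_ideal_colon:
  assumes "subring_of_field R" "submodule_over R I"
  shows "integral_ideal R (colon R I z)"
  using subring_of_fieldD[OF assms(1)] submodule_overD[OF assms(2)]
  by (auto simp: integral_ideal_def submodule_over_def colon_def distrib_right mult.assoc)

lemma fractional_idealsD:
  assumes "I \<in> fractional_ideals R"
  shows "submodule_over R I" "\<exists>d\<in>R. d \<noteq> 0 \<and> (*) d ` I \<subseteq> R"
  using assms by (auto simp: fractional_ideals_def)

lemma fractional_ideals_subset:
  assumes "I \<in> fractional_ideals R" "J \<subseteq> I" "submodule_over R J"
  shows "J \<in> fractional_ideals R"
  using assms unfolding fractional_ideals_def by blast

lemma fractional_ideals_if_integral:
  assumes "subring_of_field R" "integral_ideal R I"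
  shows "I \<in> fractional_ideals R"
  using assms subring_of_fieldD(1)[of R]
  by (auto simp: fractional_ideals_def integral_ideal_def intro!: bexI[of _ 1])

text \<open>A field has no zero divisors. The zero prime settles the degenerate cases of semifinite
  and spectral operations.\<close>

lemma zero_mem_Spec_of: "subring_of_field R \<Longrightarrow> {0} \<in> Spec_of R"
  using subring_of_fieldD[of R]
  by (auto simp: Spec_of_def integral_ideal_def submodule_over_zero)

lemma Spec_ofD:
  assumes "P \<in> Spec_of R"
  shows "integral_ideal R P" "P \<noteq> R" "\<And>x y. x \<in> R \<Longrightarrow> y \<in> R \<Longrightarrow> x * y \<in> P \<Longrightarrow> x \<in> P \<or> y \<in> P"
  using assms by (auto simp: Spec_of_def)

lemma one_mem_integral_ideal: "integral_ideal R I \<Longrightarrow> 1 \<in> I \<longleftrightarrow> I = R" if "subring_of_field R"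
  using submodule_overD(3)[of R I _ 1] subring_of_fieldD(1)[OF that]
  by (auto simp: integral_ideal_def)

lemma ext_subset_self: "subring_of_field T \<Longrightarrow> I \<subseteq> T \<Longrightarrow> ext T I \<subseteq> T"
  by (simp add: ext_minimal submodule_over_self)

lemma ext_eq_self_iff: "subring_of_field T \<Longrightarrow> I \<subseteq> T \<Longrightarrow> ext T I = T \<longleftrightarrow> 1 \<in> ext T I"
  using one_mem_integral_ideal[of T "ext T I"]
  by (simp add: integral_ideal_def submodule_over_ext ext_subset_self)

subsection \<open>Jaffard families\<close>

locale jaffard =
  fixes R :: "'k::field set" and \<Theta> :: "'k set set"
  assumes domain: "domain_with_quotient_field R"
    and jaffard_family: "jaffard_family R \<Theta>"
begin

lemma subring: "subring_of_field R"
  using domain by (simp add: domain_with_quotient_field_def)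

lemma overring_subring: "T \<in> \<Theta> \<Longrightarrow> subring_of_field T"
  and overring_superset: "T \<in> \<Theta> \<Longrightarrow> R \<subseteq> T"
  using jaffard_family by (auto simp: jaffard_family_def overring_def)

lemma factorization:
  assumes "integral_ideal R I" "I \<noteq> {0}"
  shows "I = ideal_product R {T \<in> \<Theta>. ext T I \<noteq> T} (\<lambda>T. ext T I \<inter> R)"
  using jaffard_family assms unfolding jaffard_family_def by blast

lemma comaximal:
  assumes "integral_ideal R I" "I \<noteq> {0}" "T \<in> \<Theta>" "S \<in> \<Theta>" "T \<noteq> S"
  shows "{a + b |a b. a \<in> ext T I \<inter> R \<and> b \<in> ext S I \<inter> R} = R"
proof -
  have "\<forall>T\<in>\<Theta>. \<forall>S\<in>\<Theta>. T \<noteq> S \<longrightarrow>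
      {a + b |a b. a \<in> ext T I \<inter> R \<and> b \<in> ext S I \<inter> R} = R"
    by (rule jaffard_family[unfolded jaffard_family_def, THEN conjunct2, THEN conjunct2,
          THEN conjunct2, THEN conjunct2, THEN spec, THEN mp, OF conjI[OF assms(1,2)], THEN conjunct2])
  from this[THEN bspec, OF assms(3), THEN bspec, OF assms(4), THEN mp, OF assms(5)]
  show ?thesis .
qed

lemma ext_integral_eq_iff:
  assumes "T \<in> \<Theta>" "integral_ideal R I"
  shows "ext T I = T \<longleftrightarrow> 1 \<in> ext T I"
  using assms overring_superset[of T] overring_subring[of T]
  by (intro ext_eq_self_iff) (auto simp: integral_ideal_def)

text \<open>By local finiteness a nonzero element of \<open>I\<close> is a unit in almost all
  members of \<open>\<Theta>\<close>, and \<open>I\<close> extends to the unit ideal wherever that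
  happens.\<close>

lemma finite_ext_ne:
  assumes "integral_ideal R I" "I \<noteq> {0}"
  shows "finite {T \<in> \<Theta>. ext T I \<noteq> T}"
proof -
  obtain x where x: "x \<in> I" "x \<noteq> 0" "x \<in> R"
    using assms unfolding integral_ideal_def submodule_over_def by blast
  have "1 \<in> ext T I" if "T \<in> \<Theta>" "y \<in> T" "x * y = 1" for T y
    using submodule_overD(3)[OF submodule_over_ext that(2), of x I] subset_ext[of I T] x that(3)
    by (auto simp: mult.commute)
  then have "{T \<in> \<Theta>. ext T I \<noteq> T} \<subseteq> {T \<in> \<Theta>. \<not> (\<exists>y\<in>T. x * y = 1)}"
    using ext_integral_eq_iff[OF _ assms(1)] by auto
  moreover have "finite {T \<in> \<Theta>. \<not> (\<exists>y\<in>T. x * y = 1)}"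
    using jaffard_family x by (simp add: jaffard_family_def locally_finite_family_def)
  ultimately show ?thesis
    by (rule finite_subset)
qed

text \<open>Comaximality is applied to the contraction \<open>B\<close> of \<open>ext S I\<close>.
  Since \<open>B\<close> and \<open>I\<close> have the same extension to \<open>S\<close>, it reads
  \<open>(BT \<inter> R) + B = R\<close>, and both summands lie in \<open>BT\<close>.\<close>

lemma one_mem_ext_other:
  assumes I: "integral_ideal R I" "I \<noteq> {0}" and TS: "T \<in> \<Theta>" "S \<in> \<Theta>" "T \<noteq> S"
  shows "1 \<in> ext T (ext S I \<inter> R)"
proof -
  let ?B = "ext S I \<inter> R"
  have B: "integral_ideal R ?B"
    using submodule_over_mono[OF submodule_over_ext overring_superset[OF TS(2)]]
      submodule_over_Int submodule_over_self[OF subring] by (auto simp: integral_ideal_def)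
  have IB: "I \<subseteq> ?B"
    using I subset_ext[of I S] by (auto simp: integral_ideal_def)
  then have "?B \<noteq> {0}"
    using I unfolding integral_ideal_def submodule_over_def by blast
  moreover have "ext S ?B = ext S I"
    using IB ext_mono[OF IB] ext_minimal[OF submodule_over_ext, of ?B S I] by blast
  ultimately have "1 \<in> {a + b |a b. a \<in> ext T ?B \<inter> R \<and> b \<in> ?B}"
    using comaximal[OF B _ TS] subring_of_fieldD(1)[OF subring] by simp
  then obtain a b where ab: "1 = a + b" "a \<in> ext T ?B" "b \<in> ?B"
    by blast
  have "a + b \<in> ext T ?B"
    using ab(2) subsetD[OF subset_ext ab(3)] by (rule submodule_overD(2)[OF submodule_over_ext])
  then show ?thesis
    by (simp only: ab(1))
qed

text \<open>The complementary factor in the factorization of \<open>I\<close> consists of such \<open>h\<close> and generates \<open>T\<close>.\<close>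

lemma one_mem_ext_conductor:
  assumes I: "integral_ideal R I" "I \<noteq> {0}" and T: "T \<in> \<Theta>"
  shows "1 \<in> ext T {h \<in> R. \<forall>y\<in>ext T I \<inter> R. h * y \<in> I}"
proof (cases "ext T I = T")
  case True
  \<comment> \<open>When \<open>IT = T\<close>, the elements of \<open>I\<close> itself already
    serve as multipliers.\<close>
  have "h * y \<in> I" if "h \<in> I" "y \<in> R" for h y
    using I(1) submodule_overD(3)[of R I y h] that by (simp add: integral_ideal_def mult.commute)
  then have "I \<subseteq> {h \<in> R. \<forall>y\<in>ext T I \<inter> R. h * y \<in> I}"
    using I(1) by (auto simp: integral_ideal_def)
  moreover have "1 \<in> ext T I"
    using True ext_integral_eq_iff[OF T I(1)] by simp
  ultimately show ?thesis
    using ext_monoD by blast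
next
  case False
  define F where "F = {S \<in> \<Theta>. ext S I \<noteq> S}"
  \<comment> \<open>These products omit the factor at \<open>T\<close>. Each remaining factor
    generates the unit ideal of \<open>T\<close>, by comaximality.\<close>
  define H where "H = {\<Prod>S\<in>F - {T}. f S |f. \<forall>S\<in>F - {T}. f S \<in> ext S I \<inter> R}"
  have F: "finite F" "T \<in> F"
    using finite_ext_ne[OF I] T False by (auto simp: F_def)
  have "1 \<in> ext T H"
    unfolding H_def using F one_mem_ext_other[OF I T] by (intro one_mem_ext_prod) (auto simp: F_def)
  moreover have "h * y \<in> I" if h: "h \<in> H" and y: "y \<in> ext T I \<inter> R" for h y
  proof -
    obtain f where f: "h = (\<Prod>S\<in>F - {T}. f S)" "\<forall>S\<in>F - {T}. f S \<in> ext S I \<inter> R"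
      using h by (auto simp: H_def)
    \<comment> \<open>Inserting \<open>y\<close> as the missing factor at \<open>T\<close> turns
      \<open>h * y\<close> into a generator of the full product, which is \<open>I\<close>.\<close>
    let ?g = "f(T := y)"
    have "(\<Prod>S\<in>F - {T}. ?g S) = h"
      unfolding f by (intro prod.cong) auto
    then have "(\<Prod>S\<in>F. ?g S) = h * y"
      using prod.remove[OF F, of ?g] by (simp add: mult.commute)
    moreover have "\<forall>S\<in>F. ?g S \<in> ext S I \<inter> R"
      using f y by auto
    ultimately have "h * y \<in> {\<Prod>S\<in>F. f S |f. \<forall>S\<in>F. f S \<in> ext S I \<inter> R}"
      by (intro CollectI exI[of _ ?g] conjI) simp_all
    then have "h * y \<in> ideal_product R F (\<lambda>S. ext S I \<inter> R)"
      unfolding ideal_product_def by (rule subsetD[OF hull_subset])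
    then show ?thesis
      using equalityD2[OF factorization[OF I, folded F_def]] by (rule rev_subsetD)
  qed
  moreover have "h \<in> R" if "h \<in> H" for h
  proof -
    have "(\<Prod>S\<in>G. f S) \<in> R" if "finite G" "\<forall>S\<in>G. f S \<in> R" for G and f :: "'k set \<Rightarrow> 'k"
      using that by (induction G) (auto simp: subring_of_fieldD[OF subring])
    then show ?thesis
      using F(1) that by (auto simp: H_def)
  qed
  ultimately have "H \<subseteq> {h \<in> R. \<forall>y\<in>ext T I \<inter> R. h * y \<in> I}"
    by blast
  with \<open>1 \<in> ext T H\<close> show ?thesis
    by (rule ext_monoD)
qed

text \<open>No factor is left in the factorization of \<open>C\<close>, and the empty product
  contains \<open>1\<close>.\<close>

lemma integral_eq_if_ext_eq:
  assumes "integral_ideal R C" "C \<noteq> {0}" "\<And>T. T \<in> \<Theta> \<Longrightarrow> 1 \<in> ext T C"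
  shows "C = R"
proof -
  define F where "F = {T \<in> \<Theta>. ext T C \<noteq> T}"
  have "F = {}"
    unfolding F_def using assms(3) ext_integral_eq_iff[OF _ assms(1)] by blast
  then have "ideal_product R F (\<lambda>T. ext T C \<inter> R) = submodule_over R hull {1}"
    by (simp add: ideal_product_def)
  then have "1 \<in> ideal_product R F (\<lambda>T. ext T C \<inter> R)"
    using hull_subset[of "{1}" "submodule_over R"] by simp
  then have "1 \<in> C"
    using equalityD2[OF factorization[OF assms(1,2), folded F_def]] by (rule rev_subsetD)
  then show ?thesis
    using one_mem_integral_ideal[OF subring assms(1)] by simp
qed

lemma quotientE:
  obtains a b where "a \<in> R" "b \<in> R" "b \<noteq> 0" "z = a / b"
proof -
  have "\<exists>a\<in>R. \<exists>b\<in>R. b \<noteq> 0 \<and> z = a / b"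
    using domain unfolding domain_with_quotient_field_def by simp
  then show thesis
    using that by blast
qed

text \<open>With \<open>z = a / b\<close> and a nonzero \<open>i = c / d\<close> in
  \<open>I\<close>, the nonzero element \<open>b * c\<close> of \<open>R\<close> satisfies
  \<open>b * c * z = a * (d * i)\<close>.\<close>

lemma colon_ne_zero:
  assumes I: "submodule_over R I" "I \<noteq> {0}"
  shows "colon R I z \<noteq> {0}"
proof -
  obtain a b where z: "a \<in> R" "b \<in> R" "b \<noteq> 0" "z = a / b"
    by (rule quotientE)
  obtain i where i: "i \<in> I" "i \<noteq> 0"
    using I submodule_overD(1) by blast
  obtain c d where c: "c \<in> R" "d \<in> R" "d \<noteq> 0" "i = c / d"
    by (rule quotientE)
  have "a * (d * i) \<in> I"
    using submodule_overD(3)[OF I(1)] i z c by blast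
  moreover have "b * c * z = a * (d * i)"
    using z c by simp
  ultimately have "b * c \<in> colon R I z"
    using z(2) c(1) subring_of_fieldD(4)[OF subring] unfolding colon_def by simp
  moreover have "b * c \<noteq> 0"
    using z c i by auto
  ultimately show ?thesis
    by blast
qed

section \<open>Flatness of the members of \<open>\<Theta>\<close>\<close>

text \<open>For \<open>z = a / b\<close>, the element \<open>a = z * b\<close> lies in
  \<open>bT \<inter> R\<close>. Hence every \<open>h\<close> that multiplies
  \<open>bT \<inter> R\<close> into \<open>bR\<close> is a denominator of \<open>z\<close>, and such
  \<open>h\<close> generate \<open>T\<close>.\<close>

lemma one_mem_ext_colon_self:
  assumes T: "T \<in> \<Theta>" and z: "z \<in> T"
  shows "1 \<in> ext T (colon R R z)"
proof -
  obtain a b where ab: "a \<in> R" "b \<in> R" "b \<noteq> 0" "z = a / b"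
    by (rule quotientE)
  let ?I = "(*) b ` R"
  have I: "integral_ideal R ?I"
    using submodule_over_scale[OF submodule_over_self[OF subring]] ab subring_of_fieldD[OF subring]
    by (auto simp: integral_ideal_def)
  have b: "b \<in> ?I"
    using subring_of_fieldD(1)[OF subring] by force
  then have "z * b \<in> ext T ?I"
    using subset_ext[of ?I T] submodule_overD(3)[OF submodule_over_ext z] by blast
  then have "a \<in> ext T ?I \<inter> R"
    using ab by simp
  then have "h \<in> colon R R z" if "h \<in> R" "\<forall>y\<in>ext T ?I \<inter> R. h * y \<in> ?I" for h
  proof -
    have "h * a \<in> ?I"
      using that \<open>a \<in> ext T ?I \<inter> R\<close> by blast
    then obtain r where "r \<in> R" "h * a = b * r"
      by blast
    then have "h * z = r"
      unfolding ab(4) using ab(3) by simp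
    then show ?thesis
      using \<open>r \<in> R\<close> that(1) by (simp add: colon_def)
  qed
  then have "{h \<in> R. \<forall>y\<in>ext T ?I \<inter> R. h * y \<in> ?I} \<subseteq> colon R R z"
    by blast
  moreover have "?I \<noteq> {0}"
    using b ab by blast
  then have "1 \<in> ext T {h \<in> R. \<forall>y\<in>ext T ?I \<inter> R. h * y \<in> ?I}"
    by (rule one_mem_ext_conductor[OF I _ T])
  ultimately show ?thesis
    using ext_monoD by blast
qed

text \<open>This plays the role of flatness of \<open>T\<close> over \<open>R\<close>.\<close>

lemma mem_ext_iff:
  assumes T: "T \<in> \<Theta>" and I: "submodule_over R I"
  shows "z \<in> ext T I \<longleftrightarrow> 1 \<in> ext T (colon R I z)"
proof
  assume *: "1 \<in> ext T (colon R I z)"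
  have "z * h \<in> ext T I" if "h \<in> colon R I z" for h
    using that subset_ext[of I T] by (auto simp: colon_def mult.commute)
  then show "z \<in> ext T I"
    by (rule mem_if_one_mem_ext[OF submodule_over_ext _ *])
next
  assume "z \<in> ext T I"
  \<comment> \<open>\<open>?M\<close> is a \<open>T\<close>-submodule containing \<open>I\<close>: a
    sum is handled by intersecting two colon ideals, and a multiple by \<open>t\<close> through
    products with denominators of \<open>t\<close>.\<close>
  let ?M = "{z. 1 \<in> ext T (colon R I z)}"
  have "x + y \<in> ?M" if "x \<in> ?M" "y \<in> ?M" for x y
  proof -
    have "1 \<in> ext T (colon R I x \<inter> colon R I y)"
      using that integral_ideal_colon[OF subring I] by (intro one_mem_ext_Int) auto
    moreover have "colon R I x \<inter> colon R I y \<subseteq> colon R I (x + y)"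
      using submodule_overD(2)[OF I] by (auto simp: colon_def distrib_left)
    ultimately have "1 \<in> ext T (colon R I (x + y))"
      by (rule ext_monoD)
    then show ?thesis
      by simp
  qed
  moreover have "t * x \<in> ?M" if "t \<in> T" "x \<in> ?M" for t x
  proof -
    have "1 \<in> ext T {a * b |a b. a \<in> colon R R t \<and> b \<in> colon R I x}"
      using that one_mem_ext_colon_self[OF T] by (intro one_mem_ext_mult) auto
    moreover have "a * b * (t * x) \<in> I" if "a * t \<in> R" "b * x \<in> I" for a b
      using submodule_overD(3)[OF I that] by (simp add: ac_simps)
    then have "{a * b |a b. a \<in> colon R R t \<and> b \<in> colon R I x} \<subseteq> colon R I (t * x)"
      using subring_of_fieldD(4)[OF subring] by (auto simp: colon_def)
    ultimately have "1 \<in> ext T (colon R I (t * x))"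
      by (rule ext_monoD)
    then show ?thesis
      by simp
  qed
  moreover have one: "x \<in> ?M" if "x \<in> I" for x
  proof -
    have "1 \<in> colon R I x"
      using that subring_of_fieldD(1)[OF subring] by (simp add: colon_def)
    then show ?thesis
      using subset_ext[of "colon R I x" T] by blast
  qed
  moreover have "0 \<in> ?M"
    using one submodule_overD(1)[OF I] .
  ultimately have "submodule_over T ?M"
    unfolding submodule_over_def by (intro conjI ballI)
  moreover have "I \<subseteq> ?M"
    using one by blast
  ultimately have "ext T I \<subseteq> ?M"
    by (intro ext_minimal)
  then show "1 \<in> ext T (colon R I z)"
    using \<open>z \<in> ext T I\<close> by blast
qed

text \<open>The colon ideal of an intersection is the intersection of the colon ideals, and two
  ideals of \<open>R\<close> that extend to the unit ideal have an intersection that does so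
  too.\<close>

lemma ext_Int:
  assumes T: "T \<in> \<Theta>" and "submodule_over R I" "submodule_over R J"
  shows "ext T (I \<inter> J) = ext T I \<inter> ext T J"
proof
  show "ext T (I \<inter> J) \<subseteq> ext T I \<inter> ext T J"
    by (simp add: ext_mono)
  have "z \<in> ext T (I \<inter> J)" if "z \<in> ext T I" "z \<in> ext T J" for z
  proof -
    have "1 \<in> ext T (colon R I z)" "1 \<in> ext T (colon R J z)"
      using that mem_ext_iff[OF T assms(2)] mem_ext_iff[OF T assms(3)] by auto
    then have "1 \<in> ext T (colon R I z \<inter> colon R J z)"
      using integral_ideal_colon[OF subring assms(2)] integral_ideal_colon[OF subring assms(3)]
      by (rule one_mem_ext_Int)
    moreover have "colon R I z \<inter> colon R J z = colon R (I \<inter> J) z"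
      by (auto simp: colon_def)
    ultimately show ?thesis
      using mem_ext_iff[OF T submodule_over_Int[OF assms(2,3)]] by simp
  qed
  then show "ext T I \<inter> ext T J \<subseteq> ext T (I \<inter> J)"
    by blast
qed

section \<open>Contraction, extension and the local-global principle\<close>

lemma integral_ideal_restrict:
  assumes "T \<in> \<Theta>" "integral_ideal T A"
  shows "integral_ideal R (A \<inter> R)"
  using assms overring_superset submodule_over_self[OF subring]
  by (auto simp: integral_ideal_def intro: submodule_over_Int submodule_over_mono)

text \<open>A denominator of an element \<open>z\<close> of \<open>A\<close> multiplies
  \<open>z\<close> into \<open>A \<inter> R\<close>, so the colon ideal of \<open>z\<close> in
  \<open>A \<inter> R\<close> contains all denominators of \<open>z\<close>, and these generate
  \<open>T\<close>.\<close>

lemma ext_restrict: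
  assumes T: "T \<in> \<Theta>" and A: "integral_ideal T A"
  shows "ext T (A \<inter> R) = A"
proof
  have A': "submodule_over T A" "A \<subseteq> T"
    using A by (auto simp: integral_ideal_def)
  show "ext T (A \<inter> R) \<subseteq> A"
    by (simp add: ext_minimal A')
  show "A \<subseteq> ext T (A \<inter> R)"
  proof
    fix z assume z: "z \<in> A"
    have "colon R R z \<subseteq> colon R (A \<inter> R) z"
      using submodule_overD(3)[OF A'(1)] z overring_superset[OF T] by (auto simp: colon_def)
    then have "1 \<in> ext T (colon R (A \<inter> R) z)"
      using one_mem_ext_colon_self[OF T] z A'(2) by (meson ext_monoD subsetD)
    then show "z \<in> ext T (A \<inter> R)"
      using mem_ext_iff[OF T] integral_ideal_restrict[OF T A] by (simp add: integral_ideal_def)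
  qed
qed

lemma integral_ideal_ext:
  assumes "T \<in> \<Theta>" "integral_ideal R I"
  shows "integral_ideal T (ext T I)"
  using assms overring_superset overring_subring ext_subset_self[of T I] submodule_over_ext[of T I]
  by (auto simp: integral_ideal_def)

text \<open>The colon ideal \<open>(M : z)\<close> extends to the unit ideal everywhere and is
  nonzero because \<open>M\<close> is, so it is \<open>R\<close>.\<close>

lemma mem_if_mem_ext:
  assumes M: "submodule_over R M" "M \<noteq> {0}" and z: "\<And>T. T \<in> \<Theta> \<Longrightarrow> z \<in> ext T M"
  shows "z \<in> M"
proof -
  have "colon R M z = R"
    using integral_ideal_colon[OF subring M(1)] colon_ne_zero[OF M] z mem_ext_iff[OF _ M(1)]
    by (intro integral_eq_if_ext_eq) auto
  then have "1 \<in> colon R M z"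
    using subring_of_fieldD(1)[OF subring] by simp
  then show ?thesis
    by (simp add: colon_def)
qed

text \<open>The members in question are those in which the nonzero ideal \<open>(M : z)\<close> does
  not become the unit ideal.\<close>

lemma finite_not_mem_ext:
  assumes M: "submodule_over R M" "M \<noteq> {0}"
  shows "finite {T \<in> \<Theta>. z \<notin> ext T M}"
proof -
  have "z \<in> ext T M \<longleftrightarrow> ext T (colon R M z) = T" if "T \<in> \<Theta>" for T
    using mem_ext_iff[OF that M(1)] ext_integral_eq_iff[OF that integral_ideal_colon[OF subring M(1)]]
    by simp
  then have "{T \<in> \<Theta>. z \<notin> ext T M} = {T \<in> \<Theta>. ext T (colon R M z) \<noteq> T}"
    by (intro Collect_cong) blast
  then show ?thesis
    using finite_ext_ne[OF integral_ideal_colon[OF subring M(1)] colon_ne_zero[OF M]] by simp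
qed

lemma fractional_ideals_ext:
  assumes "T \<in> \<Theta>" "I \<in> fractional_ideals R"
  shows "ext T I \<in> fractional_ideals T"
proof -
  obtain d where d: "d \<in> R" "d \<noteq> 0" "(*) d ` I \<subseteq> R"
    using fractional_idealsD(2)[OF assms(2)] by blast
  have "(*) d ` ext T I \<subseteq> T"
    unfolding ext_scale[symmetric] using d overring_superset[OF assms(1)] overring_subring[OF assms(1)]
    by (intro ext_subset_self) auto
  then show ?thesis
    using submodule_over_ext d overring_superset[OF assms(1)] by (auto simp: fractional_ideals_def)
qed

text \<open>The numerator \<open>a\<close> of the denominator \<open>d\<close> lies in
  \<open>R\<close> and still multiplies \<open>A\<close> into \<open>T\<close>. The resulting ideal
  of \<open>T\<close> is contracted to \<open>R\<close> and scaled back. Thus \<open>star_at\<close>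
  need only be evaluated at extensions of fractional ideals of \<open>R\<close>.\<close>

lemma fractional_idealE:
  assumes T: "T \<in> \<Theta>" and A: "A \<in> fractional_ideals T"
  obtains I where "I \<in> fractional_ideals R" "A = ext T I"
proof -
  obtain d where d: "d \<in> T" "d \<noteq> 0" "(*) d ` A \<subseteq> T"
    using fractional_idealsD(2)[OF A] by blast
  obtain a b where ab: "a \<in> R" "b \<in> R" "b \<noteq> 0" "d = a / b"
    by (rule quotientE)
  have a0: "a \<noteq> 0"
    using ab d by auto
  have "a * x \<in> T" if "x \<in> A" for x
  proof -
    have "b * (d * x) \<in> T"
      using d that ab overring_superset[OF T] subring_of_fieldD(4)[OF overring_subring[OF T]] by blast
    then show ?thesis
      using ab by simp
  qed
  then have A': "integral_ideal T ((*) a ` A)"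
    using submodule_over_scale fractional_idealsD(1)[OF A] by (auto simp: integral_ideal_def)
  let ?I = "(*) (inverse a) ` ((*) a ` A \<inter> R)"
  have inv: "(*) (inverse a) ` (*) a ` A = A" "(*) a ` ?I = (*) a ` A \<inter> R"
    using a0 by (auto simp: image_image mult.assoc[symmetric])
  have "A = ext T ?I"
    using ext_restrict[OF T A'] inv(1) by (simp add: ext_scale)
  moreover have "submodule_over R ?I"
    using submodule_over_scale integral_ideal_restrict[OF T A'] by (auto simp: integral_ideal_def)
  then have "?I \<in> fractional_ideals R"
    using inv(2) ab(1) a0 unfolding fractional_ideals_def
    by (metis (mono_tags, lifting) Int_lower2 mem_Collect_eq)
  ultimately show thesis
    using that by blast
qed

text \<open>A nonzero \<open>i\<close> in \<open>I\<close> has a nonzero multiple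
  \<open>r * i\<close> in \<open>J\<close>, with \<open>r\<close> taken from
  \<open>(J : i)\<close>.\<close>

lemma Int_ne_zero:
  assumes I: "submodule_over R I" "I \<noteq> {0}" and J: "submodule_over R J" "J \<noteq> {0}"
  shows "I \<inter> J \<noteq> {0}"
proof -
  obtain i where i: "i \<in> I" "i \<noteq> 0"
    using I submodule_overD(1) by blast
  obtain r where "r \<in> colon R J i" "r \<noteq> 0"
    using colon_ne_zero[OF J] integral_ideal_colon[OF subring J(1), of i] submodule_overD(1)
    by (metis integral_ideal_def singletonI subset_singletonD subsetI empty_iff)
  then have "r * i \<in> I \<inter> J" "r * i \<noteq> 0"
    using submodule_overD(3)[OF I(1) _ i(1)] i by (auto simp: colon_def)
  then show ?thesis
    by blast
qed

subsection \<open>Primes and localizations\<close>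

text \<open>Were \<open>H\<close> contained in \<open>P\<close>, \<open>1\<close> would lie in
  \<open>ext T P\<close>. With colon ideals for \<open>H\<close>, this supplies multipliers outside
  \<open>P\<close>.\<close>

lemma prime_mem_if:
  assumes P: "P \<in> Spec_of R" and T: "T \<in> \<Theta>" "1 \<notin> ext T P" and H: "H \<subseteq> R" "1 \<in> ext T H"
  obtains h where "h \<in> H" "h \<in> R" "h \<notin> P"
  using H T(2) ext_monoD[of 1 T H P] by blast

lemma prime_mult_not_mem:
  assumes P: "P \<in> Spec_of R" and "x \<in> R" "y \<in> R" "x \<notin> P" "y \<notin> P"
  shows "x * y \<notin> P"
  using assms Spec_ofD(3) by blast

lemma denominatorE:
  assumes P: "P \<in> Spec_of R" and T: "T \<in> \<Theta>" "1 \<notin> ext T P" and x: "x \<in> T"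
  obtains h where "h \<in> R" "h \<notin> P" "h * x \<in> R"
proof -
  have "colon R R x \<subseteq> R"
    by (auto simp: colon_def)
  then obtain h where "h \<in> colon R R x" "h \<notin> P"
    using prime_mem_if[OF P T _ one_mem_ext_colon_self[OF T(1) x]] by blast
  then show thesis
    using that by (auto simp: colon_def)
qed

text \<open>If every denominator of \<open>x\<close> multiplied it into \<open>P\<close>, then
  \<open>(P : x)\<close> would contain \<open>(R : x)\<close> and extend to \<open>T\<close>,
  forcing \<open>x\<close> into \<open>ext T P\<close>.\<close>

lemma numerator_not_mem:
  assumes P: "P \<in> Spec_of R" and T: "T \<in> \<Theta>" "1 \<notin> ext T P" and x: "x \<in> T" "x \<notin> ext T P"
  obtains h where "h \<in> R" "h * x \<in> R" "h * x \<notin> P"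
proof -
  have P': "submodule_over R P"
    using Spec_ofD(1)[OF P] by (simp add: integral_ideal_def)
  have "\<not> colon R R x \<subseteq> colon R P x"
    using mem_ext_iff[OF T(1) P', of x] one_mem_ext_colon_self[OF T(1) x(1)] x(2)
    by (meson ext_monoD)
  then show thesis
    using that by (auto simp: colon_def)
qed

text \<open>For \<open>x\<close> in the contraction, \<open>(P : x)\<close> extends to
  \<open>T\<close> and so contains some \<open>h\<close> outside \<open>P\<close>; primeness then
  puts \<open>x\<close> into \<open>P\<close>.\<close>

lemma ext_prime_restrict:
  assumes P: "P \<in> Spec_of R" and T: "T \<in> \<Theta>" "1 \<notin> ext T P"
  shows "ext T P \<inter> R = P"
proof
  have P': "submodule_over R P" "P \<subseteq> R"
    using Spec_ofD(1)[OF P] by (auto simp: integral_ideal_def)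
  show "P \<subseteq> ext T P \<inter> R"
    using P' subset_ext[of P T] by blast
  show "ext T P \<inter> R \<subseteq> P"
  proof
    fix x assume x: "x \<in> ext T P \<inter> R"
    then have "1 \<in> ext T (colon R P x)"
      using mem_ext_iff[OF T(1) P'(1)] by simp
    moreover have "colon R P x \<subseteq> R"
      by (auto simp: colon_def)
    ultimately obtain h where h: "h \<in> colon R P x" "h \<in> R" "h \<notin> P"
      using prime_mem_if[OF P T] by blast
    then show "x \<in> P"
      using Spec_ofD(3)[OF P] x by (auto simp: colon_def)
  qed
qed

text \<open>Two elements outside \<open>ext T P\<close> are multiplied into \<open>R\<close> but
  outside \<open>P\<close>. If their product lay in \<open>ext T P\<close>, the product of these
  multiples would lie in the contraction, which is \<open>P\<close>.\<close>

lemma Spec_of_ext: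
  assumes P: "P \<in> Spec_of R" and T: "T \<in> \<Theta>" "1 \<notin> ext T P"
  shows "ext T P \<in> Spec_of T"
proof -
  have "x * y \<notin> ext T P" if x: "x \<in> T" "x \<notin> ext T P" and y: "y \<in> T" "y \<notin> ext T P" for x y
  proof
    assume *: "x * y \<in> ext T P"
    obtain h where h: "h \<in> R" "h * x \<in> R" "h * x \<notin> P"
      using numerator_not_mem[OF P T x] .
    obtain k where k: "k \<in> R" "k * y \<in> R" "k * y \<notin> P"
      using numerator_not_mem[OF P T y] .
    have "h * k \<in> T"
      using h(1) k(1) subring_of_fieldD(4)[OF subring] overring_superset[OF T(1)] by blast
    then have "h * k * (x * y) \<in> ext T P"
      using submodule_overD(3)[OF submodule_over_ext _ *] by blast
    then have "(h * x) * (k * y) \<in> ext T P \<inter> R"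
      using subring_of_fieldD(4)[OF subring h(2) k(2)] by (simp add: ac_simps)
    then show False
      using prime_mult_not_mem[OF P h(2) k(2) h(3) k(3)] ext_prime_restrict[OF P T] by simp
  qed
  then show ?thesis
    using integral_ideal_ext[OF T(1) Spec_ofD(1)[OF P]] ext_integral_eq_iff[OF T(1) Spec_ofD(1)[OF P]] T(2)
    by (auto simp: Spec_of_def)
qed

lemma Spec_of_restrict:
  assumes T: "T \<in> \<Theta>" and Q: "Q \<in> Spec_of T"
  shows "Q \<inter> R \<in> Spec_of R" "1 \<notin> ext T (Q \<inter> R)"
proof -
  have 1: "1 \<notin> Q"
    using Spec_ofD(1,2)[OF Q] one_mem_integral_ideal[OF overring_subring[OF T]] by blast
  then show "Q \<inter> R \<in> Spec_of R"
    using integral_ideal_restrict[OF T Spec_ofD(1)[OF Q]] Spec_ofD(3)[OF Q] overring_superset[OF T]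
      subring_of_fieldD(1)[OF subring]
    by (auto simp: Spec_of_def)
  show "1 \<notin> ext T (Q \<inter> R)"
    using 1 ext_restrict[OF T Spec_ofD(1)[OF Q]] by simp
qed

text \<open>A fraction \<open>a / s\<close> over \<open>T\<close> is expanded by
  \<open>h * k\<close>: here \<open>h\<close> lies outside \<open>P\<close> and brings
  \<open>a\<close> into \<open>R\<close>, while \<open>k\<close> brings \<open>s\<close> into
  \<open>R\<close> but outside \<open>P\<close>.\<close>

lemma localization_ext:
  assumes P: "P \<in> Spec_of R" and T: "T \<in> \<Theta>" "1 \<notin> ext T P"
  shows "localization T (ext T P) = localization R P"
proof
  show "localization R P \<subseteq> localization T (ext T P)"
    using overring_superset[OF T(1)] ext_prime_restrict[OF P T] unfolding localization_def by blast
  show "localization T (ext T P) \<subseteq> localization R P"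
  proof
    fix z assume "z \<in> localization T (ext T P)"
    then obtain a s where z: "z = a / s" "a \<in> T" "s \<in> T" "s \<notin> ext T P"
      by (auto simp: localization_def)
    obtain h where h: "h \<in> R" "h \<notin> P" "h * a \<in> R"
      using denominatorE[OF P T z(2)] .
    obtain k where k: "k \<in> R" "k * s \<in> R" "k * s \<notin> P"
      using numerator_not_mem[OF P T z(3,4)] .
    have 0: "0 \<in> P"
      using Spec_ofD(1)[OF P] by (simp add: integral_ideal_def submodule_over_def)
    then have "h \<noteq> 0" "k \<noteq> 0"
      using h k by auto
    then have "z = (k * (h * a)) / (h * (k * s))"
      using z(1) by simp
    moreover have "k * (h * a) \<in> R" "h * (k * s) \<in> R" "h * (k * s) \<notin> P"
      using h k subring_of_fieldD(4)[OF subring] prime_mult_not_mem[OF P] by auto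
    ultimately show "z \<in> localization R P"
      unfolding localization_def by blast
  qed
qed

lemma subset_localization:
  assumes P: "P \<in> Spec_of R" and T: "T \<in> \<Theta>" "1 \<notin> ext T P"
  shows "T \<subseteq> localization R P"
proof
  fix x assume "x \<in> T"
  moreover have "x = x / 1"
    by simp
  ultimately have "x \<in> localization T (ext T P)"
    unfolding localization_def using T(2) subring_of_fieldD(1)[OF overring_subring[OF T(1)]] by blast
  then show "x \<in> localization R P"
    by (simp only: localization_ext[OF assms])
qed

text \<open>Localizing at \<open>P\<close> absorbs the extension to \<open>T\<close>. This lets
  primes of \<open>T\<close> be traded for primes of \<open>R\<close> in a spectral
  representation.\<close>

lemma ext_localization_ext:
  assumes P: "P \<in> Spec_of R" and T: "T \<in> \<Theta>" "1 \<notin> ext T P"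
  shows "ext (localization T (ext T P)) (ext T I) = ext (localization R P) I"
  using localization_ext[OF assms] ext_ext[OF subset_localization[OF assms]] by simp

lemma mem_ext_localization:
  assumes "s \<in> R" "s \<notin> P" "0 \<in> P" "s * z \<in> I"
  shows "z \<in> ext (localization R P) I"
proof -
  have "1 / s \<in> localization R P"
    using assms(1,2) subring_of_fieldD(1)[OF subring] by (auto simp: localization_def)
  moreover have "s * z \<in> ext (localization R P) I"
    using assms(4) subset_ext[of I] by blast
  ultimately have "1 / s * (s * z) \<in> ext (localization R P) I"
    by (rule submodule_overD(3)[OF submodule_over_ext])
  then show ?thesis
    using assms(2,3) by (auto split: if_splits)
qed

text \<open>Any nonzero element of \<open>(I : z)\<close> is an admissible denominator at the zero
  prime. Hence adding that prime to a spectral representation does not change its values at nonzero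
  ideals.\<close>

lemma ext_localization_zero:
  assumes "submodule_over R I" "I \<noteq> {0}"
  shows "ext (localization R {0}) I = UNIV"
proof -
  have "z \<in> ext (localization R {0}) I" for z
  proof -
    have "0 \<in> colon R I z"
      using integral_ideal_colon[OF subring assms(1)] by (simp add: integral_ideal_def submodule_over_def)
    then obtain s where "s \<in> colon R I z" "s \<noteq> 0"
      using colon_ne_zero[OF assms] by blast
    then show ?thesis
      by (intro mem_ext_localization[of s]) (auto simp: colon_def)
  qed
  then show ?thesis
    by blast
qed

text \<open>A prime containing \<open>A \<inter> R\<close> extends to the whole ring in every member of \<open>\<Theta>\<close> other than \<open>T\<close>.\<close>

lemma one_not_mem_ext_prime:
  assumes T: "T \<in> \<Theta>" and A: "integral_ideal T A" "A \<noteq> {0}" and P: "P \<in> Spec_of R" "A \<inter> R \<subseteq> P"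
  shows "1 \<notin> ext T P"
proof
  assume 1: "1 \<in> ext T P"
  let ?B = "A \<inter> R"
  have B: "integral_ideal R ?B" "ext T ?B = A"
    using integral_ideal_restrict ext_restrict T A by auto
  then have B0: "?B \<noteq> {0}"
    using A(2) ext_zero by metis
  have "1 \<in> ext S P" if S: "S \<in> \<Theta>" for S
  proof (cases "S = T")
    case False
    then have "1 \<in> ext S ?B"
      using one_mem_ext_other[OF B(1) B0 S T] B(2) by simp
    then show ?thesis
      using P(2) by (rule ext_monoD)
  qed (use 1 in simp)
  moreover have "P \<noteq> {0}"
    using B0 P(2) B(1) by (auto simp: integral_ideal_def submodule_over_def)
  ultimately have "P = R"
    using integral_eq_if_ext_eq Spec_ofD(1)[OF P(1)] by blast
  then show False
    using Spec_ofD(2)[OF P(1)] by simp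
qed

lemma ext_localization_restrict:
  assumes T: "T \<in> \<Theta>" and Q: "Q \<in> Spec_of T"
  shows "ext (localization T Q) (ext T I) = ext (localization R (Q \<inter> R)) I"
  using ext_localization_ext[OF Spec_of_restrict(1)[OF assms] T Spec_of_restrict(2)[OF assms]]
    ext_restrict[OF T Spec_ofD(1)[OF Q]] by simp

end

subsection \<open>Star operations and Jaffard families\<close>

text \<open>Finite type is rephrased with finite generating sets. Monotonicity suffices, so the
  criterion serves both \<open>star\<close> and \<open>star_at R star T\<close>.\<close>

lemma star_finite_type_iff:
  assumes "\<And>I J. I \<in> fractional_ideals S \<Longrightarrow> J \<in> fractional_ideals S \<Longrightarrow> I \<subseteq> J \<Longrightarrow> st I \<subseteq> st J"
  shows "star_finite_type S st \<longleftrightarrow>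
    (\<forall>I\<in>fractional_ideals S. \<forall>z\<in>st I. \<exists>X. finite X \<and> X \<subseteq> I \<and> z \<in> st (ext S X))"
    (is "_ \<longleftrightarrow> ?rhs")
proof
  assume ft: "star_finite_type S st"
  show ?rhs
  proof (intro ballI)
    fix I z assume I: "I \<in> fractional_ideals S" "z \<in> st I"
    then have "z \<in> \<Union>{st J |J. J \<subseteq> I \<and> finitely_generated_over S J}"
      using ft unfolding star_finite_type_def by simp
    then obtain J where J: "z \<in> st J" "J \<subseteq> I" "finitely_generated_over S J"
      by blast
    then obtain X where "finite X" "J = ext S X"
      by (auto simp: finitely_generated_over_iff)
    then show "\<exists>X. finite X \<and> X \<subseteq> I \<and> z \<in> st (ext S X)"
      using J(1,2) subset_ext[of X S] by (intro exI[of _ X]) simp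
  qed
next
  assume rhs: ?rhs
  show "star_finite_type S st"
    unfolding star_finite_type_def
  proof (intro ballI subset_antisym subsetI)
    fix I z assume I: "I \<in> fractional_ideals S"
    show "z \<in> \<Union>{st J |J. J \<subseteq> I \<and> finitely_generated_over S J}" if z: "z \<in> st I"
    proof -
      obtain X where X: "finite X" "X \<subseteq> I" "z \<in> st (ext S X)"
        using rhs I z by blast
      have "ext S X \<subseteq> I"
        using fractional_idealsD(1)[OF I] X(2) by (rule ext_minimal)
      moreover have "finitely_generated_over S (ext S X)"
        using X(1) finitely_generated_over_iff by blast
      ultimately show ?thesis
        using X(3) by blast
    qed
    show "z \<in> st I" if z: "z \<in> \<Union>{st J |J. J \<subseteq> I \<and> finitely_generated_over S J}"
    proof -
      obtain J where J: "z \<in> st J" "J \<subseteq> I" "finitely_generated_over S J"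
        using z by blast
      have "submodule_over S J"
        using J(3) by (auto simp: finitely_generated_over_iff submodule_over_ext)
      then have "st J \<subseteq> st I"
        by (rule assms[OF fractional_ideals_subset[OF I J(2)] I J(2)])
      then show ?thesis
        using J(1) by blast
    qed
  qed
qed

locale jaffard_star = jaffard R \<Theta>
  for R :: "'k::field set" and \<Theta> :: "'k set set" +
  fixes star :: "'k set \<Rightarrow> 'k set"
  assumes star: "star \<in> Star R"
begin

lemma star_fractional: "I \<in> fractional_ideals R \<Longrightarrow> star I \<in> fractional_ideals R"
  and star_extensive: "I \<in> fractional_ideals R \<Longrightarrow> I \<subseteq> star I"
  and star_mono: "I \<in> fractional_ideals R \<Longrightarrow> J \<in> fractional_ideals R \<Longrightarrow> I \<subseteq> J \<Longrightarrow> star I \<subseteq> star J"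
  and star_ring: "star R = R"
  and star_scale: "I \<in> fractional_ideals R \<Longrightarrow> star ((*) x ` I) = (*) x ` star I"
  using star by (auto simp: Star_def)

lemma fractional_ring: "R \<in> fractional_ideals R"
  using subring submodule_over_self[OF subring]
  by (intro fractional_ideals_if_integral) (auto simp: integral_ideal_def)

text \<open>The zero ideal is \<open>R\<close> scaled by \<open>0\<close>.\<close>

lemma star_zero: "star {0} = {0}"
proof -
  have "(*) 0 ` R = {0}"
    using subring_of_fieldD(1)[OF subring] by force
  then show ?thesis
    using star_scale[OF fractional_ring, of 0] star_ring by simp
qed

lemma submodule_star: "I \<in> fractional_ideals R \<Longrightarrow> submodule_over R (star I)"
  using star_fractional fractional_idealsD(1) by blast

lemma star_ne_zero: "I \<in> fractional_ideals R \<Longrightarrow> I \<noteq> {0} \<Longrightarrow> star I \<noteq> {0}"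
  using star_extensive[of I] submodule_overD(1)[OF fractional_idealsD(1), of I R] by blast

lemma star_subset_ring: "integral_ideal R I \<Longrightarrow> star I \<subseteq> R"
  using star_mono[OF fractional_ideals_if_integral[OF subring] fractional_ring, of I] star_ring
  by (simp add: integral_ideal_def)

section \<open>Well-definedness of the induced operations\<close>

text \<open>Scaling by \<open>h\<close> commutes with \<open>star\<close>, and \<open>star\<close>
  is monotone.\<close>

lemma mult_star_subset:
  assumes I: "I \<in> fractional_ideals R" and J: "J \<in> fractional_ideals R" and h: "(*) h ` I \<subseteq> J"
  shows "(*) h ` star I \<subseteq> star J"
proof -
  have "(*) h ` I \<in> fractional_ideals R"
    using J h submodule_over_scale[OF fractional_idealsD(1)[OF I]] by (rule fractional_ideals_subset)
  then show ?thesis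
    using star_mono[OF _ J h] star_scale[OF I] by simp
qed

text \<open>An element \<open>h\<close> that multiplies \<open>I\<close> into \<open>J\<close> also
  multiplies \<open>star I\<close> into \<open>star J\<close>, and there are enough such
  \<open>h\<close> to generate \<open>T\<close>. Both directions together make
  \<open>star_at\<close> well defined, and the inclusion itself makes it monotone.\<close>

lemma ext_star_mono:
  assumes T: "T \<in> \<Theta>" and I: "I \<in> fractional_ideals R" and J: "J \<in> fractional_ideals R"
    and IJ: "ext T I \<subseteq> ext T J"
  shows "ext T (star I) \<subseteq> ext T (star J)"
proof (cases "I = {0}")
  case True
  then show ?thesis
    using submodule_overD(1)[OF submodule_over_ext, of T "star J"] by (simp add: star_zero ext_zero)
next
  case False
  note IM = fractional_idealsD(1)[OF I] and JM = fractional_idealsD(1)[OF J]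
  have "J \<noteq> {0}"
    using False IJ subset_ext[of I T] submodule_overD(1)[OF IM] by (auto simp: ext_zero)
  obtain d where d: "d \<in> R" "d \<noteq> 0" "(*) d ` I \<subseteq> R"
    using fractional_idealsD(2)[OF I] by blast
  \<comment> \<open>Scaling by \<open>d\<close> makes \<open>I \<inter> J\<close> integral, so that
    the factorization applies; by the assumed inclusion, \<open>ext T ?K\<close> is
    \<open>ext T I\<close> scaled by \<open>d\<close>.\<close>
  let ?K = "(*) d ` (I \<inter> J)"
  have K: "integral_ideal R ?K"
    using submodule_over_scale[OF submodule_over_Int[OF IM JM], of d] d(3)
    by (auto simp: integral_ideal_def)
  have K0: "?K \<noteq> {0}"
  proof -
    have "0 \<in> I \<inter> J"
      using submodule_overD(1)[OF submodule_over_Int[OF IM JM]] .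
    then obtain k where "k \<in> I \<inter> J" "k \<noteq> 0"
      using Int_ne_zero[OF IM False JM \<open>J \<noteq> {0}\<close>] by blast
    then have "d * k \<in> ?K" "d * k \<noteq> 0"
      using d(2) by auto
    then show ?thesis
      by blast
  qed
  have extK: "ext T ?K = (*) d ` ext T I"
    using IJ by (simp add: ext_scale ext_Int[OF T IM JM] Int_absorb2)
  let ?H = "{h \<in> R. \<forall>y\<in>ext T ?K \<inter> R. h * y \<in> ?K}"
  have "z * h \<in> ext T (star J)" if z: "z \<in> star I" and h: "h \<in> ?H" for z h
  proof -
    \<comment> \<open>The multiple \<open>d * i\<close> lies in \<open>ext T ?K \<inter> R\<close>,
      so \<open>h\<close> sends it into \<open>?K\<close>, and \<open>d\<close> cancels.\<close>
    have "h * i \<in> J" if i: "i \<in> I" for i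
    proof -
      have "d * i \<in> ext T ?K \<inter> R"
        using i d(3) subset_ext[of I T] by (auto simp: extK)
      then have "h * (d * i) \<in> ?K"
        using h by blast
      then obtain k where "h * (d * i) = d * k" "k \<in> J"
        by blast
      then show ?thesis
        using d(2) by (simp add: mult.left_commute[of h d])
    qed
    then have "(*) h ` star I \<subseteq> star J"
      by (intro mult_star_subset I J) blast
    then have "h * z \<in> ext T (star J)"
      using z subset_ext[of "star J" T] by blast
    then show ?thesis
      by (simp add: mult.commute)
  qed
  then have "z \<in> ext T (star J)" if "z \<in> star I" for z
    using mem_if_one_mem_ext[OF submodule_over_ext _ one_mem_ext_conductor[OF K K0 T]] that by blast
  then show ?thesis
    by (intro ext_minimal submodule_over_ext) blast
qed

text \<open>Two fractional ideals with the same extension to \<open>T\<close> have closures with the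
  same extension, so the description in \<open>star_at\<close> determines a unique value.\<close>

lemma star_at_ext:
  assumes T: "T \<in> \<Theta>" and I: "I \<in> fractional_ideals R"
  shows "star_at R star T (ext T I) = ext T (star I)"
  unfolding star_at_def
proof (rule the_equality)
  show "\<exists>J\<in>fractional_ideals R. ext T I = ext T J \<and> ext T (star I) = ext T (star J)"
    using I by blast
next
  fix B
  assume "\<exists>J\<in>fractional_ideals R. ext T I = ext T J \<and> B = ext T (star J)"
  then show "B = ext T (star I)"
    using ext_star_mono[OF T I] ext_star_mono[OF T _ I] by (metis subset_antisym order_refl)
qed

lemma star_at_mono:
  assumes T: "T \<in> \<Theta>" and A: "A \<in> fractional_ideals T" and B: "B \<in> fractional_ideals T"
    and "A \<subseteq> B"
  shows "star_at R star T A \<subseteq> star_at R star T B"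
proof -
  obtain I where I: "I \<in> fractional_ideals R" "A = ext T I"
    using fractional_idealE[OF T A] .
  obtain J where J: "J \<in> fractional_ideals R" "B = ext T J"
    using fractional_idealE[OF T B] .
  show ?thesis
    using ext_star_mono[OF T I(1) J(1)] \<open>A \<subseteq> B\<close> I J by (simp add: star_at_ext[OF T])
qed

lemma star_at_ext_closed:
  assumes "T \<in> \<Theta>" "integral_ideal R I" "star I = I"
  shows "star_at R star T (ext T I) = ext T I"
  using star_at_ext[OF assms(1) fractional_ideals_if_integral[OF subring assms(2)]] assms(3) by simp

text \<open>The closure of \<open>A \<inter> R\<close> extends to \<open>A\<close>, hence lies in
  \<open>A\<close>; it stays inside \<open>R\<close> because \<open>R\<close> is closed.\<close>

lemma star_restrict_closed:
  assumes T: "T \<in> \<Theta>" and A: "integral_ideal T A" "star_at R star T A = A"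
  shows "star (A \<inter> R) = A \<inter> R"
proof
  have I: "integral_ideal R (A \<inter> R)"
    using integral_ideal_restrict[OF T A(1)] .
  then have F: "A \<inter> R \<in> fractional_ideals R"
    using fractional_ideals_if_integral[OF subring] by blast
  then show "A \<inter> R \<subseteq> star (A \<inter> R)"
    by (rule star_extensive)
  have "ext T (star (A \<inter> R)) = A"
    using star_at_ext[OF T F] ext_restrict[OF T A(1)] A(2) by simp
  then show "star (A \<inter> R) \<subseteq> A \<inter> R"
    using subset_ext[of "star (A \<inter> R)" T] star_subset_ring[OF I] by blast
qed

text \<open>This is the local-global principle for \<open>star I\<close>, which is nonzero since it
  contains \<open>I\<close>.\<close>

lemma mem_star_if_mem_ext:
  assumes "I \<in> fractional_ideals R" "I \<noteq> {0}" "\<And>T. T \<in> \<Theta> \<Longrightarrow> z \<in> ext T (star I)"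
  shows "z \<in> star I"
  using mem_if_mem_ext[OF submodule_star star_ne_zero] assms by blast

lemma fractional_ext_subset:
  assumes "I \<in> fractional_ideals R" "X \<subseteq> I"
  shows "ext R X \<in> fractional_ideals R"
  using assms(1) ext_minimal[OF fractional_idealsD(1)[OF assms(1)] assms(2)] submodule_over_ext
  by (rule fractional_ideals_subset)

section \<open>Transfer of the five properties\<close>

lemma star_finite_type_mem_iff:
  "star_finite_type R star \<longleftrightarrow>
    (\<forall>I\<in>fractional_ideals R. \<forall>z\<in>star I. \<exists>X. finite X \<and> X \<subseteq> I \<and> z \<in> star (ext R X))"
  by (rule star_finite_type_iff) (rule star_mono)

lemma star_at_finite_type_mem_iff:
  assumes "T \<in> \<Theta>"
  shows "star_finite_type T (star_at R star T) \<longleftrightarrow>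
    (\<forall>A\<in>fractional_ideals T. \<forall>z\<in>star_at R star T A.
      \<exists>X. finite X \<and> X \<subseteq> A \<and> z \<in> star_at R star T (ext T X))"
  by (rule star_finite_type_iff) (rule star_at_mono[OF assms])

text \<open>Downwards, an element of \<open>ext T (star I)\<close> involves only finitely many
  elements of \<open>star I\<close>, whose finite generating sets are united. Upwards, a single
  nonzero generator suffices at almost all members of \<open>\<Theta>\<close>, and each of the
  finitely many others contributes a finite set.\<close>

lemma finite_type_iff:
  "star_finite_type R star \<longleftrightarrow> (\<forall>T\<in>\<Theta>. star_finite_type T (star_at R star T))"
proof (intro iffI ballI)
  fix T assume ft: "star_finite_type R star" and T: "T \<in> \<Theta>"
  show "star_finite_type T (star_at R star T)"
    unfolding star_at_finite_type_mem_iff[OF T]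
  proof (intro ballI)
    fix A z assume A: "A \<in> fractional_ideals T" "z \<in> star_at R star T A"
    obtain I where I: "I \<in> fractional_ideals R" "A = ext T I"
      using fractional_idealE[OF T A(1)] .
    then have "z \<in> ext T (star I)"
      using A(2) star_at_ext[OF T] by simp
    from ext_finite_subset[OF this] obtain Y where Y: "finite Y" "Y \<subseteq> star I" "z \<in> ext T Y"
      by blast
    have "\<forall>y\<in>Y. \<exists>X. finite X \<and> X \<subseteq> I \<and> y \<in> star (ext R X)"
      using ft[unfolded star_finite_type_mem_iff, THEN bspec, OF I(1)] Y(2) by blast
    from bchoice[OF this] obtain f
      where f: "\<And>y. y \<in> Y \<Longrightarrow> finite (f y) \<and> f y \<subseteq> I \<and> y \<in> star (ext R (f y))"
      by auto
    let ?X = "\<Union>(f ` Y)"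
    have X: "?X \<subseteq> I"
      using f by (intro UN_least) simp
    have "y \<in> star (ext R ?X)" if y: "y \<in> Y" for y
    proof -
      have "ext R (f y) \<subseteq> ext R ?X"
        using y by (intro ext_mono) blast
      then have "star (ext R (f y)) \<subseteq> star (ext R ?X)"
        using f[OF y] X by (intro star_mono fractional_ext_subset[OF I(1)]) auto
      then show ?thesis
        using f[OF y] by blast
    qed
    then have "ext T Y \<subseteq> ext T (star (ext R ?X))"
      by (intro ext_mono) blast
    also have "\<dots> = star_at R star T (ext T ?X)"
      using star_at_ext[OF T fractional_ext_subset[OF I(1) X]] by (simp add: ext_ext overring_superset T)
    finally have "z \<in> star_at R star T (ext T ?X)"
      using Y(3) by blast
    moreover have "finite ?X"
      using f Y(1) by simp
    moreover have "?X \<subseteq> A"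
      using X subset_ext[of I T] I(2) by blast
    ultimately show "\<exists>X. finite X \<and> X \<subseteq> A \<and> z \<in> star_at R star T (ext T X)"
      by (intro exI conjI)
  qed
next
  assume ft: "\<forall>T\<in>\<Theta>. star_finite_type T (star_at R star T)"
  show "star_finite_type R star"
    unfolding star_finite_type_mem_iff
  proof (intro ballI)
    fix I z assume I: "I \<in> fractional_ideals R" and z: "z \<in> star I"
    show "\<exists>X. finite X \<and> X \<subseteq> I \<and> z \<in> star (ext R X)"
    proof (cases "I = {0}")
      case True
      then show ?thesis
        using z by (intro exI[of _ "{0}"]) (simp add: ext_zero)
    next
      case False
      then obtain i where i: "i \<in> I" "i \<noteq> 0"
        using submodule_overD(1)[OF fractional_idealsD(1)[OF I]] by blast
      have "\<exists>X. finite X \<and> X \<subseteq> I \<and> z \<in> ext T (star (ext R X))" if T: "T \<in> \<Theta>" for T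
      proof -
        have F: "ext T I \<in> fractional_ideals T"
          using fractional_ideals_ext[OF T I] .
        have "z \<in> star_at R star T (ext T I)"
          using z subset_ext[of "star I" T] star_at_ext[OF T I] by blast
        moreover have "\<forall>A\<in>fractional_ideals T. \<forall>z\<in>star_at R star T A.
            \<exists>X. finite X \<and> X \<subseteq> A \<and> z \<in> star_at R star T (ext T X)"
          using ft T star_at_finite_type_mem_iff[OF T] by simp
        ultimately obtain Y where Y: "finite Y" "Y \<subseteq> ext T I" "z \<in> star_at R star T (ext T Y)"
          using F by blast
        \<comment> \<open>The generators in \<open>Y\<close> lie only in \<open>ext T I\<close>;
          they are replaced by finitely many elements of \<open>I\<close>.\<close>
        obtain Z where Z: "finite Z" "Z \<subseteq> I" "Y \<subseteq> ext T Z"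
          using finite_subset_ext[OF Y(1,2)] by blast
        have YF: "ext T Y \<in> fractional_ideals T"
          using F ext_minimal[OF submodule_over_ext Y(2)] submodule_over_ext
          by (rule fractional_ideals_subset)
        have ZF: "ext T Z \<in> fractional_ideals T"
          using F ext_mono[OF Z(2)] submodule_over_ext by (rule fractional_ideals_subset)
        have "star_at R star T (ext T Y) \<subseteq> star_at R star T (ext T Z)"
          using ext_minimal[OF submodule_over_ext Z(3)] by (rule star_at_mono[OF T YF ZF])
        also have "\<dots> = ext T (star (ext R Z))"
          using star_at_ext[OF T fractional_ext_subset[OF I Z(2)]]
          by (simp add: ext_ext overring_superset T)
        finally show ?thesis
          using Y(3) Z(1,2) by blast
      qed
      then have "\<forall>T\<in>\<Theta>. \<exists>X. finite X \<and> X \<subseteq> I \<and> z \<in> ext T (star (ext R X))"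
        by blast
      from bchoice[OF this] obtain f
        where f: "\<And>T. T \<in> \<Theta> \<Longrightarrow> finite (f T) \<and> f T \<subseteq> I \<and> z \<in> ext T (star (ext R (f T)))"
        by auto
      \<comment> \<open>The exceptional members, where the fixed generator \<open>i\<close> alone is
        not enough for \<open>z\<close>.\<close>
      define F where "F = {T \<in> \<Theta>. z \<notin> ext T (star (ext R {i}))}"
      have nz: "ext R Y \<noteq> {0}" if "i \<in> Y" for Y
        using i(2) that subset_ext[of Y R] by blast
      have iF: "ext R {i} \<in> fractional_ideals R"
        using fractional_ext_subset[OF I] i(1) by simp
      have F: "finite F"
        unfolding F_def using finite_not_mem_ext[OF submodule_star[OF iF] star_ne_zero[OF iF nz]] by simp
      let ?X = "insert i (\<Union>(f ` F))"
      have X: "?X \<subseteq> I"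
        using f i(1) by (auto simp: F_def)
      have mono: "ext T (star (ext R Y)) \<subseteq> ext T (star (ext R ?X))" if "Y \<subseteq> ?X" for T Y
        using that X by (intro ext_mono star_mono fractional_ext_subset[OF I]) auto
      have "z \<in> ext T (star (ext R ?X))" if T: "T \<in> \<Theta>" for T
      proof (cases "T \<in> F")
        case True
        then have "f T \<subseteq> ?X"
          by blast
        then show ?thesis
          using mono f[OF T] by blast
      next
        case False
        then have "z \<in> ext T (star (ext R {i}))"
          using T by (simp add: F_def)
        then show ?thesis
          using mono[of "{i}" T] by blast
      qed
      then have "z \<in> star (ext R ?X)"
        using nz by (intro mem_star_if_mem_ext fractional_ext_subset[OF I X]) auto
      moreover have "finite ?X"
        using F f by (simp add: F_def)
      ultimately show ?thesis
        using X by blast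
    qed
  qed
qed

text \<open>Closed ideals contract and extend to closed ideals. Downwards, a closed prime of
  \<open>R\<close> above a nonzero contraction from \<open>T\<close> stays proper in
  \<open>T\<close>; upwards, a proper nonzero ideal of \<open>R\<close> stays proper in some member
  of \<open>\<Theta>\<close>, and a closed prime found there is contracted.\<close>

lemma semifinite_iff:
  "star_semifinite R star \<longleftrightarrow> (\<forall>T\<in>\<Theta>. star_semifinite T (star_at R star T))"
proof (intro iffI ballI)
  fix T assume sf: "star_semifinite R star" and T: "T \<in> \<Theta>"
  show "star_semifinite T (star_at R star T)"
    unfolding star_semifinite_def
  proof (intro allI impI, elim conjE)
    fix A assume A: "integral_ideal T A" "A \<noteq> T" "star_at R star T A = A"
    show "\<exists>Q\<in>Spec_of T. star_at R star T Q = Q \<and> A \<subseteq> Q"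
    \<comment> \<open>A prime above the contraction of the zero ideal could become the unit ideal in
      \<open>T\<close>, but a closed zero ideal is itself the required prime.\<close>
    proof (cases "A = {0}")
      case True
      then show ?thesis
        using zero_mem_Spec_of[OF overring_subring[OF T]] A(3) by blast
    next
      case False
      have "1 \<notin> A"
        using one_mem_integral_ideal[OF overring_subring[OF T] A(1)] A(2) by simp
      then have "A \<inter> R \<noteq> R"
        using subring_of_fieldD(1)[OF subring] by blast
      then obtain P where P: "P \<in> Spec_of R" "star P = P" "A \<inter> R \<subseteq> P"
        using sf integral_ideal_restrict[OF T A(1)] star_restrict_closed[OF T A(1,3)]
        unfolding star_semifinite_def by blast
      have "ext T P \<in> Spec_of T"
        using Spec_of_ext[OF P(1) T one_not_mem_ext_prime[OF T A(1) False P(1,3)]] .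
      moreover have "A \<subseteq> ext T P"
        using ext_restrict[OF T A(1)] ext_mono[OF P(3), of T] by simp
      ultimately show ?thesis
        using star_at_ext_closed[OF T Spec_ofD(1)[OF P(1)] P(2)] by blast
    qed
  qed
next
  assume sf: "\<forall>T\<in>\<Theta>. star_semifinite T (star_at R star T)"
  show "star_semifinite R star"
    unfolding star_semifinite_def
  proof (intro allI impI, elim conjE)
    fix I assume I: "integral_ideal R I" "I \<noteq> R" "star I = I"
    show "\<exists>P\<in>Spec_of R. star P = P \<and> I \<subseteq> P"
    proof (cases "I = {0}")
      case True
      then show ?thesis
        using zero_mem_Spec_of[OF subring] I(3) by blast
    next
      case False
      then obtain T where T: "T \<in> \<Theta>" "1 \<notin> ext T I"
        using integral_eq_if_ext_eq[OF I(1)] I(2) by blast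
      have "ext T I \<noteq> T"
        using T ext_integral_eq_iff[OF T(1) I(1)] by simp
      moreover have "star_semifinite T (star_at R star T)"
        using sf T(1) by blast
      ultimately obtain Q where Q: "Q \<in> Spec_of T" "star_at R star T Q = Q" "ext T I \<subseteq> Q"
        using integral_ideal_ext[OF T(1) I(1)] star_at_ext_closed[OF T(1) I(1,3)]
        unfolding star_semifinite_def by blast
      have "I \<subseteq> Q \<inter> R"
        using Q(3) subset_ext[of I T] I(1) by (auto simp: integral_ideal_def)
      then show ?thesis
        using Spec_of_restrict(1)[OF T(1) Q(1)] star_restrict_closed[OF T(1) Spec_ofD(1)[OF Q(1)] Q(2)]
        by blast
    qed
  qed
qed

text \<open>Extension to \<open>T\<close> commutes with intersections, so the identity passes to
  \<open>T\<close>. Conversely it is checked in every \<open>T\<close>, with zero ideals apart since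
  the local-global principle asks for a nonzero \<open>I \<inter> J\<close>.\<close>

lemma stable_iff: "star_stable R star \<longleftrightarrow> (\<forall>T\<in>\<Theta>. star_stable T (star_at R star T))"
proof (intro iffI ballI)
  fix T assume st: "star_stable R star" and T: "T \<in> \<Theta>"
  show "star_stable T (star_at R star T)"
    unfolding star_stable_def
  proof (intro ballI)
    fix A B assume A: "A \<in> fractional_ideals T" and B: "B \<in> fractional_ideals T"
    obtain I where I: "I \<in> fractional_ideals R" "A = ext T I"
      using fractional_idealE[OF T A] .
    obtain J where J: "J \<in> fractional_ideals R" "B = ext T J"
      using fractional_idealE[OF T B] .
    have IJ: "submodule_over R (I \<inter> J)"
      using fractional_idealsD(1) I(1) J(1) submodule_over_Int by blast
    have "star_at R star T (A \<inter> B) = star_at R star T (ext T (I \<inter> J))"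
      using I(2) J(2) ext_Int[OF T fractional_idealsD(1)[OF I(1)] fractional_idealsD(1)[OF J(1)]]
      by simp
    also have "\<dots> = ext T (star (I \<inter> J))"
      by (intro star_at_ext[OF T] fractional_ideals_subset[OF I(1) _ IJ]) blast
    also have "\<dots> = ext T (star I \<inter> star J)"
      using st I(1) J(1) unfolding star_stable_def by simp
    also have "\<dots> = ext T (star I) \<inter> ext T (star J)"
      by (intro ext_Int[OF T] submodule_star I(1) J(1))
    finally show "star_at R star T (A \<inter> B) = star_at R star T A \<inter> star_at R star T B"
      using I J star_at_ext[OF T] by simp
  qed
next
  assume st: "\<forall>T\<in>\<Theta>. star_stable T (star_at R star T)"
  show "star_stable R star"
    unfolding star_stable_def
  proof (intro ballI)
    fix I J assume I: "I \<in> fractional_ideals R" and J: "J \<in> fractional_ideals R"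
    note IM = fractional_idealsD(1)[OF I] and JM = fractional_idealsD(1)[OF J]
    have IJ: "I \<inter> J \<in> fractional_ideals R"
      using I _ submodule_over_Int[OF IM JM] by (rule fractional_ideals_subset) blast
    show "star (I \<inter> J) = star I \<inter> star J"
    proof
      show "star (I \<inter> J) \<subseteq> star I \<inter> star J"
        using star_mono[OF IJ I] star_mono[OF IJ J] by blast
      show "star I \<inter> star J \<subseteq> star (I \<inter> J)"
      proof (cases "I = {0} \<or> J = {0}")
        case True
        then have "star I \<inter> star J \<subseteq> {0}"
          using star_zero by auto
        then show ?thesis
          using submodule_overD(1)[OF submodule_star[OF IJ]] by blast
      next
        case False
        show ?thesis
        proof
          fix z assume z: "z \<in> star I \<inter> star J"
          have "z \<in> ext T (star (I \<inter> J))" if T: "T \<in> \<Theta>" for T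
          proof -
            have "star_at R star T (ext T I \<inter> ext T J) = star_at R star T (ext T I) \<inter> star_at R star T (ext T J)"
              using st T fractional_ideals_ext[OF T I] fractional_ideals_ext[OF T J]
              unfolding star_stable_def by blast
            then have "ext T (star (I \<inter> J)) = ext T (star I) \<inter> ext T (star J)"
              using star_at_ext[OF T IJ] star_at_ext[OF T I] star_at_ext[OF T J] ext_Int[OF T IM JM]
              by simp
            then show ?thesis
              using z subset_ext[of "star I" T] subset_ext[of "star J" T] by blast
          qed
          then show "z \<in> star (I \<inter> J)"
            using False by (intro mem_star_if_mem_ext[OF IJ] Int_ne_zero IM JM) auto
        qed
      qed
    qed
  qed
qed

text \<open>Downwards, the primes of \<open>R\<close> that stay proper in \<open>T\<close> are
  extended to \<open>T\<close>; upwards, the primes from all members are contracted to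
  \<open>R\<close>. The localizations involved give the same modules.\<close>

lemma spectral_iff: "star_spectral R star \<longleftrightarrow> (\<forall>T\<in>\<Theta>. star_spectral T (star_at R star T))"
proof (intro iffI ballI)
  fix T assume "star_spectral R star" and T: "T \<in> \<Theta>"
  then obtain D0 where D0: "D0 \<subseteq> Spec_of R"
    and star_D0: "\<forall>I\<in>fractional_ideals R. star I = \<Inter>{ext (localization R P) I |P. P \<in> D0}"
    unfolding star_spectral_def by (elim exE conjE) (rule that)
  \<comment> \<open>Adding the zero prime does not change the operation, and keeps the index set for \<open>T\<close> nonempty.\<close>
  define D where "D = insert {0} D0"
  have D: "P \<in> Spec_of R" if "P \<in> D" for P
    using that D0 zero_mem_Spec_of[OF subring] by (auto simp: D_def)
  have star_D: "z \<in> star I \<longleftrightarrow> (\<forall>P\<in>D. z \<in> ext (localization R P) I)"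
    if I: "I \<in> fractional_ideals R" for I z
  proof (cases "I = {0}")
    case True
    then show ?thesis
      by (auto simp: star_zero ext_zero D_def)
  next
    case False
    then have "ext (localization R {0}) I = UNIV"
      using ext_localization_zero[OF fractional_idealsD(1)[OF I]] by simp
    then show ?thesis
      using star_D0[THEN bspec, OF I] by (auto simp: D_def)
  qed
  let ?D = "{ext T P |P. P \<in> D \<and> 1 \<notin> ext T P}"
  have sub: "?D \<subseteq> Spec_of T"
    using Spec_of_ext[OF D T] by blast
  have eq: "star_at R star T A = \<Inter>{ext (localization T Q) A |Q. Q \<in> ?D}"
    if A: "A \<in> fractional_ideals T" for A
  proof -
    obtain I where I: "I \<in> fractional_ideals R" "A = ext T I"
      using fractional_idealE[OF T A] .
    note IM = fractional_idealsD(1)[OF I(1)]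
    have "z \<in> ext T (star I)" if z: "\<And>P. P \<in> D \<Longrightarrow> 1 \<notin> ext T P \<Longrightarrow> z \<in> ext (localization R P) I" for z
    proof (cases "I = {0}")
      case True
      have "z \<in> ext (localization R {0}) I"
        by (rule z) (auto simp: D_def ext_zero)
      then show ?thesis
        using True by (simp add: ext_zero star_zero)
    next
      case False
      \<comment> \<open>The multipliers \<open>h\<close> of \<open>ext T ?C \<inter> R\<close> into
        \<open>?C\<close> generate \<open>T\<close>. It is shown that each \<open>z * h\<close> lies
        in the localized \<open>I\<close> at every \<open>P\<close> in \<open>D\<close>, including
        those lost in \<open>T\<close>, so that \<open>z * h\<close> lies in
        \<open>star I\<close>.\<close>
      let ?C = "colon R I z"
      have C: "integral_ideal R ?C" "?C \<noteq> {0}"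
        using integral_ideal_colon[OF subring IM] colon_ne_zero[OF IM False] by auto
      have C': "ext T ?C \<noteq> {0}"
        using C subset_ext[of ?C T] submodule_overD(1)[of R ?C] by (auto simp: integral_ideal_def)
      have "z * h \<in> ext (localization R P) I"
        if h: "h \<in> R" "\<forall>y\<in>ext T ?C \<inter> R. h * y \<in> ?C" and P: "P \<in> D" for h P
      proof (cases "1 \<in> ext T P")
        case True
        \<comment> \<open>A prime that becomes the unit ideal in \<open>T\<close> cannot contain the
          contraction of the nonzero ideal \<open>ext T ?C\<close>.\<close>
        then obtain r where r: "r \<in> ext T ?C" "r \<in> R" "r \<notin> P"
          using one_not_mem_ext_prime[OF T integral_ideal_ext[OF T C(1)] C' D[OF P]] by blast
        then have "h * r \<in> ?C"
          using h(2) by blast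
        then have "r * (z * h) \<in> I"
          by (simp add: colon_def ac_simps)
        moreover have "0 \<in> P"
          using Spec_ofD(1)[OF D[OF P]] by (simp add: integral_ideal_def submodule_over_def)
        ultimately show ?thesis
          using mem_ext_localization r(2,3) by blast
      next
        case False
        then have "h \<in> localization R P"
          using subset_localization[OF D[OF P] T] h(1) overring_superset[OF T] by blast
        then show ?thesis
          using submodule_overD(3)[OF submodule_over_ext _ z[OF P False]] by (simp add: mult.commute)
      qed
      then have "z * h \<in> ext T (star I)" if "h \<in> {h \<in> R. \<forall>y\<in>ext T ?C \<inter> R. h * y \<in> ?C}" for h
        using that star_D[OF I(1)] subset_ext[of "star I" T] by blast
      then show ?thesis
        using mem_if_one_mem_ext[OF submodule_over_ext _ one_mem_ext_conductor[OF C T]] by blast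
    qed
    moreover have "ext T (star I) \<subseteq> ext (localization R P) I" if P: "P \<in> D" "1 \<notin> ext T P" for P
      using star_D[OF I(1)] P(1) submodule_over_mono[OF submodule_over_ext
          subset_localization[OF D[OF P(1)] T P(2)]]
      by (intro ext_minimal) blast+
    moreover have "ext (localization T (ext T P)) A = ext (localization R P) I"
      if "P \<in> D" "1 \<notin> ext T P" for P
      using ext_localization_ext[OF D T] that I(2) by simp
    ultimately have "z \<in> ext T (star I) \<longleftrightarrow>
        (\<forall>P\<in>D. 1 \<notin> ext T P \<longrightarrow> z \<in> ext (localization T (ext T P)) A)" for z
      by (metis subsetD)
    moreover have "{ext (localization T Q) A |Q. Q \<in> ?D} =
        (\<lambda>P. ext (localization T (ext T P)) A) ` {P \<in> D. 1 \<notin> ext T P}"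
      by blast
    ultimately have "ext T (star I) = \<Inter>{ext (localization T Q) A |Q. Q \<in> ?D}"
      by auto
    then show ?thesis
      using star_at_ext[OF T I(1)] I(2) by simp
  qed
  show "star_spectral T (star_at R star T)"
    unfolding star_spectral_def by (intro exI[of _ ?D] conjI ballI sub eq)
next
  assume "\<forall>T\<in>\<Theta>. star_spectral T (star_at R star T)"
  then have "\<forall>T\<in>\<Theta>. \<exists>D. D \<subseteq> Spec_of T \<and>
      (\<forall>A\<in>fractional_ideals T. star_at R star T A = \<Inter>{ext (localization T Q) A |Q. Q \<in> D})"
    unfolding star_spectral_def .
  from bchoice[OF this] obtain D
    where all_D: "\<forall>T\<in>\<Theta>. D T \<subseteq> Spec_of T \<and>
      (\<forall>A\<in>fractional_ideals T. star_at R star T A = \<Inter>{ext (localization T Q) A |Q. Q \<in> D T})" ..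
  note D = all_D[THEN bspec, THEN conjunct1]
    and star_at_D = all_D[THEN bspec, THEN conjunct2, THEN bspec]
  \<comment> \<open>The zero prime accounts for the ideal 0 and, when \<open>R\<close> is the whole field, for \<open>\<Theta> = {}\<close>.\<close>
  let ?D = "insert {0} {Q \<inter> R |Q T. T \<in> \<Theta> \<and> Q \<in> D T}"
  have sub: "?D \<subseteq> Spec_of R"
    using Spec_of_restrict(1) D zero_mem_Spec_of[OF subring] by blast
  have eq: "star I = \<Inter>{ext (localization R P) I |P. P \<in> ?D}" if I: "I \<in> fractional_ideals R" for I
  proof (cases "I = {0}")
    case True
    then show ?thesis
      by (auto simp: star_zero ext_zero)
  next
    case False
    have mem_D: "z \<in> ext T (star I) \<longleftrightarrow> (\<forall>Q\<in>D T. z \<in> ext (localization R (Q \<inter> R)) I)"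
      if T: "T \<in> \<Theta>" for T z
    proof -
      have "ext (localization T Q) (ext T I) = ext (localization R (Q \<inter> R)) I" if "Q \<in> D T" for Q
        using ext_localization_restrict[OF T] D[OF T] that by blast
      then show ?thesis
        using star_at_D[OF T fractional_ideals_ext[OF T I]] star_at_ext[OF T I]
        by (simp add: Setcompr_eq_image)
    qed
    have mem: "z \<in> star I \<longleftrightarrow> (\<forall>T\<in>\<Theta>. \<forall>Q\<in>D T. z \<in> ext (localization R (Q \<inter> R)) I)" for z
      using mem_star_if_mem_ext[OF I False, of z] subset_ext[of "star I"] mem_D[of _ z] by blast
    have zero: "ext (localization R {0}) I = UNIV"
      using ext_localization_zero[OF fractional_idealsD(1)[OF I] False] .
    \<comment> \<open>At a nonzero \<open>I\<close> the zero prime contributes the whole field,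
      which does not affect the intersection.\<close>
    have "{ext (localization R P) I |P. P \<in> ?D} =
        insert UNIV (\<Union>T\<in>\<Theta>. (\<lambda>Q. ext (localization R (Q \<inter> R)) I) ` D T)"
      unfolding zero[symmetric] by blast
    then show ?thesis
      using mem by auto
  qed
  show "star_spectral R star"
    unfolding star_spectral_def by (intro exI[of _ ?D] conjI ballI sub eq)
qed

text \<open>Downwards, a chain in \<open>T\<close> is recovered from its contraction. Upwards, once
  a chain has a nonzero member, all but finitely many extended chains are constant from there on, so
  one index serves for all of \<open>\<Theta>\<close> and the local-global principle
  applies.\<close>

lemma noetherian_iff: "star_noetherian R star \<longleftrightarrow> (\<forall>T\<in>\<Theta>. star_noetherian T (star_at R star T))"
proof (intro iffI ballI)
  fix T assume noeth: "star_noetherian R star" and T: "T \<in> \<Theta>"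
  show "star_noetherian T (star_at R star T)"
    unfolding star_noetherian_def
  proof (intro allI impI, elim conjE)
    fix A :: "nat \<Rightarrow> 'k set"
    assume A: "\<forall>n. integral_ideal T (A n) \<and> star_at R star T (A n) = A n"
      and chain: "\<forall>n. A n \<subseteq> A (Suc n)"
    have "\<forall>n. integral_ideal R (A n \<inter> R) \<and> star (A n \<inter> R) = A n \<inter> R"
      using A integral_ideal_restrict[OF T] star_restrict_closed[OF T] by simp
    moreover have "\<forall>n. A n \<inter> R \<subseteq> A (Suc n) \<inter> R"
      using chain by blast
    ultimately obtain N where N: "\<forall>n\<ge>N. A n \<inter> R = A N \<inter> R"
      using noeth[unfolded star_noetherian_def, THEN spec, of "\<lambda>n. A n \<inter> R"] by blast
    have "A n = A N" if "n \<ge> N" for n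
    proof -
      have "ext T (A n \<inter> R) = A n" "ext T (A N \<inter> R) = A N"
        using ext_restrict[OF T] A by blast+
      moreover have "A n \<inter> R = A N \<inter> R"
        using N that by blast
      ultimately show ?thesis
        by metis
    qed
    then show "\<exists>N. \<forall>n\<ge>N. A n = A N"
      by blast
  qed
next
  assume noeth: "\<forall>T\<in>\<Theta>. star_noetherian T (star_at R star T)"
  show "star_noetherian R star"
    unfolding star_noetherian_def
  proof (intro allI impI, elim conjE)
    fix I :: "nat \<Rightarrow> 'k set"
    assume I: "\<forall>n. integral_ideal R (I n) \<and> star (I n) = I n"
      and chain: "\<forall>n. I n \<subseteq> I (Suc n)"
    have mono: "I m \<subseteq> I n" if "m \<le> n" for m n
      using lift_Suc_mono_le[of I, OF chain[rule_format] that] .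
    show "\<exists>N. \<forall>n\<ge>N. I n = I N"
    proof (cases "\<exists>m. I m \<noteq> {0}")
      case True
      then obtain m where m: "I m \<noteq> {0}"
        by blast
      have "\<exists>N. \<forall>n\<ge>N. ext T (I n) = ext T (I N)" if T: "T \<in> \<Theta>" for T
      proof -
        have "\<forall>n. integral_ideal T (ext T (I n)) \<and> star_at R star T (ext T (I n)) = ext T (I n)"
          using I integral_ideal_ext[OF T] star_at_ext_closed[OF T] by simp
        moreover have "\<forall>n. ext T (I n) \<subseteq> ext T (I (Suc n))"
          by (intro allI ext_mono chain[rule_format])
        ultimately show ?thesis
          using noeth[THEN bspec, OF T, unfolded star_noetherian_def, THEN spec, of "\<lambda>n. ext T (I n)"]
          by blast
      qed
      then have "\<forall>T\<in>\<Theta>. \<exists>N. \<forall>n\<ge>N. ext T (I n) = ext T (I N)"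
        by blast
      from bchoice[OF this] obtain N
        where N: "\<And>T n. T \<in> \<Theta> \<Longrightarrow> n \<ge> N T \<Longrightarrow> ext T (I n) = ext T (I (N T))"
        by auto
      define F where "F = {T \<in> \<Theta>. ext T (I m) \<noteq> T}"
      have F: "finite F"
        unfolding F_def using I m by (intro finite_ext_ne) auto
      \<comment> \<open>The sum bounds every \<open>N T\<close> with \<open>T\<close> in
        \<open>F\<close>, and the summand \<open>m\<close> takes care of the members outside
        \<open>F\<close>.\<close>
      define K where "K = m + (\<Sum>T\<in>F. N T)"
      have ext_eq_K: "ext T (I n) = ext T (I K)" if n: "n \<ge> K" and T: "T \<in> \<Theta>" for n T
      proof (cases "T \<in> F")
        case True
        then have "N T \<le> K"
          using member_le_sum[of T F N] F by (simp add: K_def)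
        then show ?thesis
          using N[OF T, of n] N[OF T, of K] n by (metis order_trans)
      next
        case False
        then have "ext T (I m) = T"
          using T by (simp add: F_def)
        then have "ext T (I k) = T" if "k \<ge> m" for k
          using ext_mono[OF mono[OF that], of T] integral_ideal_ext[OF T, of "I k"] I
          by (auto simp: integral_ideal_def)
        then show ?thesis
          using n by (simp add: K_def)
      qed
      have "I n = I K" if n: "n \<ge> K" for n
      proof
        have K: "submodule_over R (I K)" "I K \<noteq> {0}"
          using I m mono[of m K] submodule_overD(1)[of R "I m"]
          by (auto simp: integral_ideal_def K_def)
        show "I n \<subseteq> I K"
          using mem_if_mem_ext[OF K] ext_eq_K[OF n] subset_ext[of "I n"] by blast
        show "I K \<subseteq> I n"
          using mono[OF n] .
      qed
      then show ?thesis
        by blast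
    qed simp
  qed
qed

end

theorem theorem5p6:
  fixes R :: "'k::field set" and \<Theta> :: "'k set set" and star :: "'k set \<Rightarrow> 'k set"
  assumes "domain_with_quotient_field R"
    and "jaffard_family R \<Theta>"
    and "star \<in> Star R"
  shows "(star_finite_type R star \<longleftrightarrow> (\<forall>T\<in>\<Theta>. star_finite_type T (star_at R star T))) \<and>
         (star_semifinite R star \<longleftrightarrow> (\<forall>T\<in>\<Theta>. star_semifinite T (star_at R star T))) \<and>
         (star_stable R star \<longleftrightarrow> (\<forall>T\<in>\<Theta>. star_stable T (star_at R star T))) \<and>
         (star_spectral R star \<longleftrightarrow> (\<forall>T\<in>\<Theta>. star_spectral T (star_at R star T))) \<and>
         (star_noetherian R star \<longleftrightarrow> (\<forall>T\<in>\<Theta>. star_noetherian T (star_at R star T)))"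
proof -
  interpret jaffard_star R \<Theta> star
    using assms by unfold_locales
  show ?thesis
    using finite_type_iff semifinite_iff stable_iff spectral_iff noetherian_iff by blast
qed

end
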